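(* Consider a theory of oriented compact virtual knots with two parities, i.e. one in which every chord of every Gauss diagram carries an index in $\mathbb{Z}_2\oplus\mathbb{Z}_2$ satisfying the parity axioms. Let $K,K'$ be two isotopic oriented $c$-even virtual knots in this theory, and let $w(K),w(K')\in D$ be the elements obtained from Gauss diagrams of $K$ and $K'$ with (arbitrarily chosen) reference points (see context). Then $w(K)$ and $w(K')$ can be obtained from each other by a finite sequence of conjugations in $D$ and automorphisms of $D$ of the following forms: $$\phi: D\to D,\quad \phi(a)=bab,\ \phi(b)=aba,\ \phi(A)=A,\ \phi(B)=B;$$ $$\psi: D\to D,\quad \psi(a)=a,\ \psi(b)=b,\ \psi(A)=BAB,\ \psi(B)=ABA;$$ $$\chi: D\to D,\quad \chi=\phi\circ\psi=\psi\circ\phi.$$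
   Context: **Theory with two parities.** Oriented compact virtual knots are considered via Gauss diagrams on the oriented circle: finitely many chords, each with an overcrossing end and an undercrossing end (and a sign), the chord ends being distinct points of the circle. Diagrams are considered up to Reidemeister moves 1, 2, 3. In a third Reidemeister move, the six ends of the three chords form three pairs of adjacent ends, one pair for each two of the chords; in each pair the two ends exchange places; one pair consists of two overcrossing ends, one of two undercrossing ends, and one of an overcrossing end and an undercrossing end. Each chord of each diagram of the theory has an index in $\mathbb{Z}_2\oplus\mathbb{Z}_2$ (the pair of its two parities). The three non-trivial elements of this group are named $a,b,c$, and a chord with index zero is said to have trivial index. The parity axioms hold: - the chord of a first Reidemeister move has trivial index; - the two chords of a second Reidemeister move have equal index; - the indices of the three chords of a third Reidemeister move sum to zero (so if two chords of different non-trivial indices take part, the third chord has the third non-trivial index; if two chords have the same index, the third has trivial index), and corresponding chords before and after this move have the same index; - chords not taking part in a move keep their index. Two knots are isotopic if their diagrams are connected by a finite sequence of Reidemeister moves in the theory. A knot is *$c$-even* if the number of chords of index $c$ of some (hence, any) of its Gauss diagrams is even. **The word $w$.** Choose a reference point on the circle, distinct from all chord ends; cutting the circle there gives a Gauss diagram $G$ on the oriented line (a long knot diagram), with the same chords and indices. Letters are associated to the ends of chords of index $a$ and $b$ only. An undercrossing end of a chord of index $a$ gets letter $a$ or $a'$, an overcrossing end of such a chord gets $A$ or $A'$; similarly undercrossing ends of chords of index $b$ get $b$ or $b'$, and overcrossing ends get $B$ or $B'$. The prime is determined as follows. - For an undercrossing end of a chord of index $a$ or $b$: consider the opposite (overcrossing)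 end of the same chord, and count the undercrossing ends of chords of index $c$ which precede that opposite end on the line. Put a prime if and only if this number is odd. - For an overcrossing end of a chord of index $a$ or $b$: consider the opposite (undercrossing) end of the same chord, and count the overcrossing ends of chords of index $c$ which precede that opposite end on the line. Put a prime if and only if this number is odd. The word $w(G)$ is obtained by reading these letters from left to right along the line. Ends of chords of index $c$ and of trivial index contribute no letters. For a knot $K$, $w(K)$ denotes the element of $D$ represented by $w(G)$, for a diagram of $K$ with a reference point. **The group $D$.** $D$ is the group generated by $a,a',b,b',A,A',B,B'$ with the relations: 1. $x^2=1$ for each of the eight generators $x$; 2. any two of $a,a',A,A'$ commute, and any two of $b,b',B,B'$ commute; 3. $[a,B]=[a,B']=[a',B]=[a',B']=[b,A]=[b,A']=[b',A]=[b',A']=1$; 4. $ab=b'a=ba'=a'b'$ and $ba=ab'=a'b=b'a'$; 5. $AB=B'A=BA'=A'B'$ and $BA=AB'=A'B=B'A'$. In $D$ one has $a'=bab$, $b'=aba$, $A'=BAB$, $B'=ABA$, and $D$ is isomorphic to $\langle a,b\mid a^2=b^2=(ab)^4=1\rangle\oplus\langle A,B\mid A^2=B^2=(AB)^4=1\rangle$; in particular $D$ is generated by $a,b,A,B$, and the automorphisms in the claim are specified by their values on these generators. *)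

theory Defs
  imports "HOL-Algebra.Group" "HOL-Library.Z2" "HOL-Library.Product_Plus"
begin

section \<open>Groups given by generators and relations\<close>

text \<open>A letter \<open>(x, True)\<close> stands for the generator \<open>x\<close> and \<open>(x, False)\<close> for its inverse. A
  relation \<open>r = s\<close> is the pair \<open>(r, s)\<close> of words.\<close>

type_synonym 'g word = "('g \<times> bool) list"

inductive word_eq :: "('g word \<times> 'g word) set \<Rightarrow> 'g word \<Rightarrow> 'g word \<Rightarrow> bool" for R where
  word_eq_refl: "word_eq R u u"
| word_eq_sym: "word_eq R u v \<Longrightarrow> word_eq R v u"
| word_eq_trans: "word_eq R u v \<Longrightarrow> word_eq R v w \<Longrightarrow> word_eq R u w"
| word_eq_cancel: "word_eq R (u @ [(x, e), (x, \<not> e)] @ v) (u @ v)"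
| word_eq_rel: "(r, s) \<in> R \<Longrightarrow> word_eq R (u @ r @ v) (u @ s @ v)"

definition word_class :: "('g word \<times> 'g word) set \<Rightarrow> 'g word \<Rightarrow> 'g word set" where
  "word_class R u = {v. word_eq R u v}"

definition presented_group :: "('g word \<times> 'g word) set \<Rightarrow> 'g word set monoid" where
  "presented_group R =
     \<lparr>carrier = range (word_class R),
      mult = (\<lambda>X Y. {w. \<exists>x\<in>X. \<exists>y\<in>Y. word_eq R (x @ y) w}),
      one = word_class R []\<rparr>"

lemma word_eq_context: "word_eq R u v \<Longrightarrow> word_eq R (p @ u @ q) (p @ v @ q)"
proof (induction rule: word_eq.induct)
  case (word_eq_cancel u x e v)
  show ?case using word_eq.word_eq_cancel[of R "p @ u" x e "v @ q"] by simp
next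
  case (word_eq_rel r s u v)
  then show ?case using word_eq.word_eq_rel[of r s R "p @ u" "v @ q"] by simp
qed (blast intro: word_eq.intros)+

lemma word_eq_append: "word_eq R u u' \<Longrightarrow> word_eq R v v' \<Longrightarrow> word_eq R (u @ v) (u' @ v')"
  using word_eq_context[of R u u' "[]" v] word_eq_context[of R v v' u' "[]"]
  by (auto intro: word_eq_trans)

lemma word_class_eq_iff: "word_class R u = word_class R v \<longleftrightarrow> word_eq R u v"
  unfolding word_class_def by (blast intro: word_eq_refl word_eq_sym word_eq_trans)

lemma carrier_presented_group: "carrier (presented_group R) = range (word_class R)"
  by (simp add: presented_group_def)

lemma one_presented_group: "\<one>\<^bsub>presented_group R\<^esub> = word_class R []"
  by (simp add: presented_group_def)

lemma mult_presented_group: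
  "word_class R u \<otimes>\<^bsub>presented_group R\<^esub> word_class R v = word_class R (u @ v)"
  unfolding presented_group_def word_class_def
  by (auto intro: word_eq_refl) (blast intro: word_eq_append word_eq_trans)

lemma word_eq_inverse: "word_eq R (map (\<lambda>(x, e). (x, \<not> e)) (rev u) @ u) []"
proof (induction u)
  case Nil
  show ?case by (simp add: word_eq_refl)
next
  case (Cons l u)
  obtain x e where l: "l = (x, e)" by fastforce
  have "word_eq R (map (\<lambda>(x, e). (x, \<not> e)) (rev u) @ [(x, \<not> e), (x, \<not> \<not> e)] @ u)
     (map (\<lambda>(x, e). (x, \<not> e)) (rev u) @ u)"
    by (rule word_eq_cancel)
  with Cons.IH show ?case by (auto simp: l intro: word_eq_trans)
qed

lemma group_presented_group: "group (presented_group R)"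
proof (rule groupI)
  fix X assume "X \<in> carrier (presented_group R)"
  then obtain u where u: "X = word_class R u" by (auto simp: carrier_presented_group)
  show "\<exists>Y\<in>carrier (presented_group R). Y \<otimes>\<^bsub>presented_group R\<^esub> X = \<one>\<^bsub>presented_group R\<^esub>"
    by (rule bexI[of _ "word_class R (map (\<lambda>(x, e). (x, \<not> e)) (rev u))"])
      (simp_all only: u carrier_presented_group mult_presented_group one_presented_group
        word_class_eq_iff word_eq_inverse rangeI)
qed (auto simp: carrier_presented_group mult_presented_group one_presented_group)


section \<open>The group \<open>D\<close>\<close>

datatype gen = ga | ga' | gb | gb' | gA | gA' | gB | gB'

abbreviation positive_word :: "'g list \<Rightarrow> 'g word" where
  "positive_word \<equiv> map (\<lambda>x. (x, True))"

definition commutator_word :: "'g \<Rightarrow> 'g \<Rightarrow> 'g word" where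
  "commutator_word x y = [(x, True), (y, True), (x, False), (y, False)]"

definition chain_rel :: "'g list \<Rightarrow> 'g list \<Rightarrow> 'g list \<Rightarrow> 'g list \<Rightarrow> ('g word \<times> 'g word) set" where
  "chain_rel p q r s =
     {(positive_word p, positive_word q), (positive_word q, positive_word r),
      (positive_word r, positive_word s)}"

definition D_rel :: "(gen word \<times> gen word) set" where
  "D_rel =
     {(positive_word [x, x], []) | x. True}
   \<union> {(positive_word [x, y], positive_word [y, x]) | x y.
        x \<in> {ga, ga', gA, gA'} \<and> y \<in> {ga, ga', gA, gA'}}
   \<union> {(positive_word [x, y], positive_word [y, x]) | x y.
        x \<in> {gb, gb', gB, gB'} \<and> y \<in> {gb, gb', gB, gB'}}
   \<union> {(commutator_word x y, []) | x y. x \<in> {ga, ga'} \<and> y \<in> {gB, gB'}}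
   \<union> {(commutator_word x y, []) | x y. x \<in> {gb, gb'} \<and> y \<in> {gA, gA'}}
   \<union> chain_rel [ga, gb] [gb', ga] [gb, ga'] [ga', gb']
   \<union> chain_rel [gb, ga] [ga, gb'] [ga', gb] [gb', ga']
   \<union> chain_rel [gA, gB] [gB', gA] [gB, gA'] [gA', gB']
   \<union> chain_rel [gB, gA] [gA, gB'] [gA', gB] [gB', gA']"

definition D :: "gen word set monoid" where
  "D = presented_group D_rel"

definition in_D :: "gen list \<Rightarrow> gen word set" where
  "in_D w = word_class D_rel (positive_word w)"

definition is_phi :: "(gen word set \<Rightarrow> gen word set) \<Rightarrow> bool" where
  "is_phi f \<longleftrightarrow> f \<in> iso D D
     \<and> f (in_D [ga]) = in_D [gb] \<otimes>\<^bsub>D\<^esub> in_D [ga] \<otimes>\<^bsub>D\<^esub> in_D [gb]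
     \<and> f (in_D [gb]) = in_D [ga] \<otimes>\<^bsub>D\<^esub> in_D [gb] \<otimes>\<^bsub>D\<^esub> in_D [ga]
     \<and> f (in_D [gA]) = in_D [gA]
     \<and> f (in_D [gB]) = in_D [gB]"

definition is_psi :: "(gen word set \<Rightarrow> gen word set) \<Rightarrow> bool" where
  "is_psi f \<longleftrightarrow> f \<in> iso D D
     \<and> f (in_D [ga]) = in_D [ga]
     \<and> f (in_D [gb]) = in_D [gb]
     \<and> f (in_D [gA]) = in_D [gB] \<otimes>\<^bsub>D\<^esub> in_D [gA] \<otimes>\<^bsub>D\<^esub> in_D [gB]
     \<and> f (in_D [gB]) = in_D [gA] \<otimes>\<^bsub>D\<^esub> in_D [gB] \<otimes>\<^bsub>D\<^esub> in_D [gA]"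

definition conj_or_apply ::
    "(gen word set \<Rightarrow> gen word set) set \<Rightarrow> gen word set \<Rightarrow> gen word set \<Rightarrow> bool" where
  "conj_or_apply F x y \<longleftrightarrow> x \<in> carrier D \<and>
     ((\<exists>g\<in>carrier D. y = g \<otimes>\<^bsub>D\<^esub> x \<otimes>\<^bsub>D\<^esub> inv\<^bsub>D\<^esub> g) \<or> (\<exists>f\<in>F. y = f x))"


section \<open>Gauss diagrams\<close>

text \<open>A Gauss diagram on the oriented line is given by the sequence of its chord ends from left to
  right, the sign of a chord being recorded at both of its ends; a Gauss diagram on the oriented
  circle is the class of such a sequence under rotation. The elements of this class are the results
  of cutting the circle at a reference point.\<close>

datatype role = Over | Under

datatype 'c chord_end = End (chord_of: 'c) (role_of: role) (positive: bool)

type_synonym 'c long_diagram = "'c chord_end list"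
type_synonym 'c diagram = "'c long_diagram set"

fun other_role :: "role \<Rightarrow> role" where
  "other_role Over = Under"
| "other_role Under = Over"

definition opposite :: "'c chord_end \<Rightarrow> 'c chord_end" where
  "opposite e = End (chord_of e) (other_role (role_of e)) (positive e)"

definition long_gauss_diagram :: "'c long_diagram \<Rightarrow> bool" where
  "long_gauss_diagram xs \<longleftrightarrow> distinct xs \<and> (\<forall>e\<in>set xs. opposite e \<in> set xs) \<and>
     (\<forall>e\<in>set xs. \<forall>f\<in>set xs. chord_of e = chord_of f \<longrightarrow> f = e \<or> f = opposite e)"

definition closure_diagram :: "'c long_diagram \<Rightarrow> 'c diagram" where
  "closure_diagram xs = range (\<lambda>n. rotate n xs)"

definition gauss_diagram :: "'c diagram \<Rightarrow> bool" where
  "gauss_diagram G \<longleftrightarrow> (\<exists>xs. long_gauss_diagram xs \<and> G = closure_diagram xs)"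

definition chords :: "'c diagram \<Rightarrow> 'c set" where
  "chords G = (\<Union>xs\<in>G. chord_of ` set xs)"


section \<open>Reidemeister moves\<close>

text \<open>The moves relate Gauss diagrams; a chord keeps its name if it is present before and after the
  move. Since a cut of the circle is chosen freely, one may always cut in front of one of the
  segments that take part.\<close>

definition reidemeister1 :: "'c \<Rightarrow> 'c diagram \<Rightarrow> 'c diagram \<Rightarrow> bool" where
  "reidemeister1 k G H \<longleftrightarrow> (\<exists>e u. chord_of e = k \<and>
     G = closure_diagram u \<and> H = closure_diagram ([e, opposite e] @ u))"

definition reidemeister2 :: "'c \<Rightarrow> 'c \<Rightarrow> 'c diagram \<Rightarrow> 'c diagram \<Rightarrow> bool" where
  "reidemeister2 p q G H \<longleftrightarrow> (\<exists>s u v. let x = End p Over s; y = End q Over (\<not> s) in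
     G = closure_diagram (u @ v) \<and>
     (H = closure_diagram ([x, y] @ u @ [opposite x, opposite y] @ v) \<or>
      H = closure_diagram ([x, y] @ u @ [opposite y, opposite x] @ v)))"

definition ordered_pair :: "bool \<Rightarrow> 'a \<Rightarrow> 'a \<Rightarrow> 'a list" where
  "ordered_pair t x y = (if t then [x, y] else [y, x])"

text \<open>In a third move \<open>p\<close> is the crossing of the top with the middle strand, \<open>q\<close> that of the top
  with the bottom strand, \<open>r\<close> that of the middle with the bottom strand. The flags \<open>tT\<close>, \<open>tM\<close>,
  \<open>tB\<close> tell whether the top strand meets \<open>p\<close> before \<open>q\<close>, the middle one \<open>p\<close> before \<open>r\<close>, the bottom
  one \<open>q\<close> before \<open>r\<close>.

  Sign condition: let \<open>T\<close>, \<open>M\<close>, \<open>B\<close> be the direction vectors of the three strands and let \<open>oT\<close>,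
  \<open>oM\<close>, \<open>oB\<close> be the flags as signs. The signs of \<open>p\<close>, \<open>q\<close>, \<open>r\<close> are those of \<open>det(T, M)\<close>,
  \<open>det(T, B)\<close>, \<open>det(M, B)\<close>. The sides of the triangle \<open>pqr\<close> give \<open>\<beta> M = \<alpha> T + \<gamma> B\<close>, where
  \<open>\<alpha>\<close>, \<open>\<beta>\<close>, \<open>\<gamma>\<close> have the signs \<open>oT\<close>, \<open>oM\<close>, \<open>oB\<close>; taking determinants with \<open>T\<close> and \<open>B\<close>, the
  signs of \<open>p\<close>, \<open>q\<close>, \<open>r\<close> are \<open>oB\<close>, \<open>oM\<close>, \<open>oT\<close> up to a common factor. This leaves precisely the
  eight oriented third moves.

  The second disjunct is the other cyclic order of the three strands along the knot.\<close>

definition reidemeister3 :: "'c \<Rightarrow> 'c \<Rightarrow> 'c \<Rightarrow> 'c diagram \<Rightarrow> 'c diagram \<Rightarrow> bool" where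
  "reidemeister3 p q r G H \<longleftrightarrow> (\<exists>sp sq sr tT tM tB u v w.
     let x = End p Over sp; y = End q Over sq; z = End r Over sr;
         top = (\<lambda>t. ordered_pair t x y);
         middle = (\<lambda>t. ordered_pair t (opposite x) z);
         bottom = (\<lambda>t. ordered_pair t (opposite y) (opposite z))
     in (sp = sq \<longleftrightarrow> tB = tM) \<and> (sq = sr \<longleftrightarrow> tM = tT) \<and>
        (G = closure_diagram (top tT @ u @ middle tM @ v @ bottom tB @ w) \<and>
         H = closure_diagram (top (\<not> tT) @ u @ middle (\<not> tM) @ v @ bottom (\<not> tB) @ w)
       \<or> G = closure_diagram (top tT @ u @ bottom tB @ v @ middle tM @ w) \<and>
         H = closure_diagram (top (\<not> tT) @ u @ bottom (\<not> tB) @ v @ middle (\<not> tM) @ w)))"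


section \<open>Theories with two parities\<close>

text \<open>A theory consists of a set \<open>T\<close> of Gauss diagrams and an index for every chord of every
  diagram in \<open>T\<close>; values at other arguments are irrelevant.\<close>

type_synonym index = "bit \<times> bit"

definition two_parity_theory :: "'c diagram set \<Rightarrow> ('c diagram \<Rightarrow> 'c \<Rightarrow> index) \<Rightarrow> bool" where
  "two_parity_theory T ind \<longleftrightarrow>
     (\<forall>G\<in>T. gauss_diagram G) \<and>
     (\<forall>G\<in>T. \<forall>H\<in>T. \<forall>k. reidemeister1 k G H \<longrightarrow>
        ind H k = 0 \<and> (\<forall>d\<in>chords G. ind H d = ind G d)) \<and>
     (\<forall>G\<in>T. \<forall>H\<in>T. \<forall>p q. reidemeister2 p q G H \<longrightarrow>
        ind H p = ind H q \<and> (\<forall>d\<in>chords G. ind H d = ind G d)) \<and>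
     (\<forall>G\<in>T. \<forall>H\<in>T. \<forall>p q r. reidemeister3 p q r G H \<longrightarrow>
        ind G p + ind G q + ind G r = 0 \<and> (\<forall>d\<in>chords G. ind H d = ind G d))"

text \<open>Names of chords carry no meaning: diagrams that differ by a renaming of the chords which
  respects the indices represent the same diagram with indices.\<close>

definition same_up_to_names ::
    "('c diagram \<Rightarrow> 'c \<Rightarrow> index) \<Rightarrow> 'c diagram \<Rightarrow> 'c diagram \<Rightarrow> bool" where
  "same_up_to_names ind G H \<longleftrightarrow> (\<exists>f. inj_on f (chords G) \<and>
     H = map (map_chord_end f) ` G \<and> (\<forall>d\<in>chords G. ind H (f d) = ind G d))"

definition isotopy_step ::
    "'c diagram set \<Rightarrow> ('c diagram \<Rightarrow> 'c \<Rightarrow> index) \<Rightarrow> 'c diagram \<Rightarrow> 'c diagram \<Rightarrow> bool" where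
  "isotopy_step T ind G H \<longleftrightarrow> G \<in> T \<and> H \<in> T \<and>
     ((\<exists>k. reidemeister1 k G H) \<or> (\<exists>p q. reidemeister2 p q G H) \<or>
      (\<exists>p q r. reidemeister3 p q r G H) \<or> same_up_to_names ind G H)"

definition isotopic ::
    "'c diagram set \<Rightarrow> ('c diagram \<Rightarrow> 'c \<Rightarrow> index) \<Rightarrow> 'c diagram \<Rightarrow> 'c diagram \<Rightarrow> bool" where
  "isotopic T ind = equivclp (isotopy_step T ind)"

text \<open>A knot is given by any of its diagrams \<open>G\<close>; its diagrams are those isotopic to \<open>G\<close>.\<close>

definition even_knot ::
    "'c diagram set \<Rightarrow> ('c diagram \<Rightarrow> 'c \<Rightarrow> index) \<Rightarrow> index \<Rightarrow> 'c diagram \<Rightarrow> bool" where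
  "even_knot T ind c G \<longleftrightarrow>
     (\<exists>H. isotopic T ind G H \<and> even (card {d \<in> chords H. ind H d = c}))"


section \<open>The word \<open>w\<close>\<close>

text \<open>In both cases of the rule for primes the ends of index \<open>c\<close> that are counted have the same role
  as the end \<open>e\<close> that gets the letter.\<close>

definition primed :: "('c \<Rightarrow> index) \<Rightarrow> index \<Rightarrow> 'c long_diagram \<Rightarrow> 'c chord_end \<Rightarrow> bool" where
  "primed \<iota> c xs e \<longleftrightarrow>
     odd (length (filter (\<lambda>f. role_of f = role_of e \<and> \<iota> (chord_of f) = c)
       (takeWhile (\<lambda>f. f \<noteq> opposite e) xs)))"

definition letters ::
    "('c \<Rightarrow> index) \<Rightarrow> index \<Rightarrow> index \<Rightarrow> index \<Rightarrow> 'c long_diagram \<Rightarrow> 'c chord_end \<Rightarrow> gen list" where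
  "letters \<iota> a b c xs e =
     (if \<iota> (chord_of e) = a then
        [case role_of e of
           Under \<Rightarrow> if primed \<iota> c xs e then ga' else ga
         | Over \<Rightarrow> if primed \<iota> c xs e then gA' else gA]
      else if \<iota> (chord_of e) = b then
        [case role_of e of
           Under \<Rightarrow> if primed \<iota> c xs e then gb' else gb
         | Over \<Rightarrow> if primed \<iota> c xs e then gB' else gB]
      else [])"

definition w_word ::
    "('c \<Rightarrow> index) \<Rightarrow> index \<Rightarrow> index \<Rightarrow> index \<Rightarrow> 'c long_diagram \<Rightarrow> gen list" where
  "w_word \<iota> a b c xs = concat (map (letters \<iota> a b c xs) xs)"

definition w :: "('c \<Rightarrow> index) \<Rightarrow> index \<Rightarrow> index \<Rightarrow> index \<Rightarrow> 'c long_diagram \<Rightarrow> gen word set" where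
  "w \<iota> a b c xs = in_D (w_word \<iota> a b c xs)"

end

theory Submission
  imports Defs
begin

text \<open>The relations of \<open>D\<close> are made such that \<open>w\<close> can be followed through every elementary change of a
  diagram. There are two kinds of changes.

  Moving the reference point across one chord end \<open>e\<close>. If \<open>e\<close> carries a letter, this letter goes from the
  front of the word to the end: a conjugation. If \<open>e\<close> is an under-end of index \<open>c\<close>, the number of
  under-ends of index \<open>c\<close> before any other place drops by one, so that all primes of lower-case letters are
  toggled; as \<open>a' = bab\<close> and \<open>b' = aba\<close> in \<open>D\<close>, this is \<open>\<phi>\<close>. In the same way an over-end of index \<open>c\<close> gives
  \<open>\<psi>\<close>. When a letter is moved, the place that determines the letter at the other end of its chord jumps from
  the front of the line to its end; the prime survives because the number of chords of index \<open>c\<close> is even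
  (\<open>primed_rotate1\<close>, \<open>w_rotate\<close>).

  Reidemeister moves. For suitable reference points they do not change \<open>w\<close> at all (\<open>w_reidemeister1\<close>, \<open>w_reidemeister2\<close>,
  \<open>w_reidemeister3\<close>). A first move concerns a chord without letters; a second move inserts two squares; a third move
  exchanges three pairs of adjacent ends. In the third move an exchange of two ends of the same role affects no
  prime, because a prime of an end \<open>e\<close> counts only ends whose role is not that of the end opposite to \<open>e\<close>. The
  exchange of the over-end of one chord with the under-end of another one toggles a prime at the other end of the
  first chord if the second one has index \<open>c\<close>, and vice versa. In this case the other two chords have indices \<open>a\<close>
  and \<open>b\<close> or have indices \<open>0\<close> and \<open>c\<close>. The toggled letter, if there is one, is then one of two letters of the same
  role that exchange places, and \<open>ab = b'a\<close>, \<open>ba = a'b\<close> and their variants absorb the toggle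
  (\<open>letter_exchange\<close>).

  The automorphisms \<open>\<phi>\<close> and \<open>\<psi>\<close> exist because toggling the primes of all lower-case, or of all capital letters
  permutes the relations up to consequences (\<open>toggle_prime_respects\<close>). They are commuting involutions, so the
  equivalence generated by them and by the conjugations is symmetric, and the steps of an isotopy, taken in either
  direction, can be composed. The number of chords of index \<open>c\<close> keeps its parity in every step, so all
  intermediate diagrams admit a change of the reference point.\<close>

section \<open>Automorphisms that permute generators\<close>

lemma word_eq_inverse_right: "word_eq R (u @ map (\<lambda>(x, e). (x, \<not> e)) (rev u)) []"
  using word_eq_inverse[of R "map (\<lambda>(x, e). (x, \<not> e)) (rev u)"]
  by (simp add: rev_map comp_def case_prod_unfold)

lemma map_apfst_involution:
  assumes "\<And>x. \<sigma> (\<sigma> x) = x"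
  shows "map (apfst \<sigma>) (map (apfst \<sigma>) u) = u"
  by (induction u) (auto simp: assms)

text \<open>The map induced on word classes by a substitution of generators. It is written as a union over all
  representatives, so that no representative has to be chosen; if the substitution respects the
  relations, all classes in the union coincide.\<close>
definition rename_generators ::
    "('g \<Rightarrow> 'g) \<Rightarrow> ('g word \<times> 'g word) set \<Rightarrow> 'g word set \<Rightarrow> 'g word set" where
  "rename_generators \<sigma> R X = (\<Union>u\<in>X. word_class R (map (apfst \<sigma>) u))"

lemma word_eq_map_generators:
  assumes "\<And>r s. (r, s) \<in> R \<Longrightarrow> word_eq R (map (apfst \<sigma>) r) (map (apfst \<sigma>) s)"
    and "word_eq R u v"
  shows "word_eq R (map (apfst \<sigma>) u) (map (apfst \<sigma>) v)"
  using assms(2)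
proof (induction rule: word_eq.induct)
  case (word_eq_cancel u x e v)
  show ?case
    using word_eq.word_eq_cancel[of R "map (apfst \<sigma>) u" "\<sigma> x" e "map (apfst \<sigma>) v"] by simp
next
  case (word_eq_rel r s u v)
  show ?case
    using word_eq_context[OF assms(1)[OF word_eq_rel]] by simp
qed (blast intro: word_eq.intros)+

lemma rename_generators_word_class:
  assumes "\<And>r s. (r, s) \<in> R \<Longrightarrow> word_eq R (map (apfst \<sigma>) r) (map (apfst \<sigma>) s)"
  shows "rename_generators \<sigma> R (word_class R u) = word_class R (map (apfst \<sigma>) u)"
proof -
  have "word_class R (map (apfst \<sigma>) v) = word_class R (map (apfst \<sigma>) u)"
    if "v \<in> word_class R u" for v
    using word_eq_map_generators[OF assms, of u v] that
    by (metis word_class_eq_iff word_class_def mem_Collect_eq)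
  moreover have "u \<in> word_class R u"
    by (simp add: word_class_def word_eq_refl)
  ultimately show ?thesis
    unfolding rename_generators_def by blast
qed

lemma rename_generators_iso:
  assumes respects: "\<And>r s. (r, s) \<in> R \<Longrightarrow> word_eq R (map (apfst \<sigma>) r) (map (apfst \<sigma>) s)"
    and involution: "\<And>x. \<sigma> (\<sigma> x) = x"
  shows "rename_generators \<sigma> R \<in> iso (presented_group R) (presented_group R)"
proof -
  note on_class = rename_generators_word_class[OF respects]
  \<comment> \<open>The induced map is its own inverse, whence its bijectivity.\<close>
  have twice_class: "rename_generators \<sigma> R (rename_generators \<sigma> R X) = X"
    if "X \<in> carrier (presented_group R)" for X
    using that by (auto simp: carrier_presented_group on_class map_apfst_involution[OF involution] simp del: map_map)
  have closed: "rename_generators \<sigma> R X \<in> carrier (presented_group R)"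
    if "X \<in> carrier (presented_group R)" for X
    using that by (auto simp: carrier_presented_group on_class)
  have "bij_betw (rename_generators \<sigma> R) (carrier (presented_group R)) (carrier (presented_group R))"
    by (rule bij_betw_byWitness[where f' = "rename_generators \<sigma> R"]) (auto simp: twice_class closed)
  moreover have "rename_generators \<sigma> R \<in> hom (presented_group R) (presented_group R)"
    by (rule homI) (auto simp: carrier_presented_group on_class mult_presented_group)
  ultimately show ?thesis
    by (simp add: iso_def)
qed

section \<open>Calculations in the group D\<close>

lemma in_D_eq_iff: "in_D u = in_D v \<longleftrightarrow> word_eq D_rel (positive_word u) (positive_word v)"
  by (simp add: in_D_def word_class_eq_iff)

lemma in_D_append: "in_D (u @ v) = in_D u \<otimes>\<^bsub>D\<^esub> in_D v"
  by (simp add: in_D_def D_def mult_presented_group)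

lemma in_D_closed: "in_D u \<in> carrier D"
  by (simp add: in_D_def D_def carrier_presented_group)

interpretation D: group D
  unfolding D_def by (rule group_presented_group)

text \<open>The links of the chains form one case, because toggling primes acts on a chain as a whole: it fixes the
  chain or reverses it.\<close>
lemma D_rel_cases:
  assumes "(r, s) \<in> D_rel"
  obtains (square) x where "r = positive_word [x, x]" "s = []"
    | (commute_a) x y where "r = positive_word [x, y]" "s = positive_word [y, x]"
        "x \<in> {ga, ga', gA, gA'}" "y \<in> {ga, ga', gA, gA'}"
    | (commute_b) x y where "r = positive_word [x, y]" "s = positive_word [y, x]"
        "x \<in> {gb, gb', gB, gB'}" "y \<in> {gb, gb', gB, gB'}"
    | (commutator_aB) x y where "r = commutator_word x y" "s = []" "x \<in> {ga, ga'}" "y \<in> {gB, gB'}"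
    | (commutator_bA) x y where "r = commutator_word x y" "s = []" "x \<in> {gb, gb'}" "y \<in> {gA, gA'}"
    | (chain) "(r, s) \<in> chain_rel [ga, gb] [gb', ga] [gb, ga'] [ga', gb']
        \<union> chain_rel [gb, ga] [ga, gb'] [ga', gb] [gb', ga']
        \<union> chain_rel [gA, gB] [gB', gA] [gB, gA'] [gA', gB']
        \<union> chain_rel [gB, gA] [gA, gB'] [gA', gB] [gB', gA']"
  using assms unfolding D_rel_def Un_assoc
  apply (elim UnE)
          apply (blast intro: square)
         apply (blast intro: commute_a)
        apply (blast intro: commute_b)
       apply (blast intro: commutator_aB)
      apply (blast intro: commutator_bA)
     apply (rule chain, simp only: Un_iff simp_thms)+
  done

lemma D_rel_mem:
  "(positive_word [x, x], []) \<in> D_rel"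
  "x \<in> {ga, ga', gA, gA'} \<Longrightarrow> y \<in> {ga, ga', gA, gA'} \<Longrightarrow>
    (positive_word [x, y], positive_word [y, x]) \<in> D_rel"
  "x \<in> {gb, gb', gB, gB'} \<Longrightarrow> y \<in> {gb, gb', gB, gB'} \<Longrightarrow>
    (positive_word [x, y], positive_word [y, x]) \<in> D_rel"
  "x \<in> {ga, ga'} \<Longrightarrow> y \<in> {gB, gB'} \<Longrightarrow> (commutator_word x y, []) \<in> D_rel"
  "x \<in> {gb, gb'} \<Longrightarrow> y \<in> {gA, gA'} \<Longrightarrow> (commutator_word x y, []) \<in> D_rel"
proof -
  have "{(positive_word [x, x], []) | x. True} \<subseteq> D_rel"
    "{(positive_word [x, y], positive_word [y, x]) | x y.
        x \<in> {ga, ga', gA, gA'} \<and> y \<in> {ga, ga', gA, gA'}} \<subseteq> D_rel"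
    "{(positive_word [x, y], positive_word [y, x]) | x y.
        x \<in> {gb, gb', gB, gB'} \<and> y \<in> {gb, gb', gB, gB'}} \<subseteq> D_rel"
    "{(commutator_word x y, []) | x y. x \<in> {ga, ga'} \<and> y \<in> {gB, gB'}} \<subseteq> D_rel"
    "{(commutator_word x y, []) | x y. x \<in> {gb, gb'} \<and> y \<in> {gA, gA'}} \<subseteq> D_rel"
    by (rule subsetI, simp only: D_rel_def Un_iff simp_thms)+
  note parts = this[THEN subsetD]
  show "(positive_word [x, x], []) \<in> D_rel"
    by (rule parts(1)) blast
  show "(positive_word [x, y], positive_word [y, x]) \<in> D_rel"
    if "x \<in> {ga, ga', gA, gA'}" "y \<in> {ga, ga', gA, gA'}"
    by (rule parts(2)) (use that in blast)
  show "(positive_word [x, y], positive_word [y, x]) \<in> D_rel"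
    if "x \<in> {gb, gb', gB, gB'}" "y \<in> {gb, gb', gB, gB'}"
    by (rule parts(3)) (use that in blast)
  show "(commutator_word x y, []) \<in> D_rel" if "x \<in> {ga, ga'}" "y \<in> {gB, gB'}"
    by (rule parts(4)) (use that in blast)
  show "(commutator_word x y, []) \<in> D_rel" if "x \<in> {gb, gb'}" "y \<in> {gA, gA'}"
    by (rule parts(5)) (use that in blast)
qed

lemma in_D_rel:
  assumes "(positive_word u, positive_word v) \<in> D_rel"
  shows "in_D u = in_D v"
  using word_eq_rel[OF assms, of "[]" "[]"] by (simp add: in_D_eq_iff)

lemma in_D_square: "in_D [x, x] = in_D []"
  using in_D_rel[of "[x, x]" "[]"] D_rel_mem(1) by simp

lemma in_D_commutator:
  assumes "(commutator_word x y, []) \<in> D_rel"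
  shows "in_D [x, y] = in_D [y, x]"
proof -
  have "word_eq D_rel (commutator_word x y @ positive_word [y, x]) (positive_word [y, x])"
    using word_eq_rel[OF assms, of "[]" "positive_word [y, x]"] by simp
  moreover have "word_eq D_rel (commutator_word x y @ positive_word [y, x]) (positive_word [x, y])"
    using word_eq_context[OF word_eq_inverse_right[of D_rel "[(x, False), (y, False)]"],
        of "positive_word [x, y]" "[]"]
    by (simp add: commutator_word_def)
  ultimately show ?thesis
    by (auto simp: in_D_eq_iff intro: word_eq_sym word_eq_trans)
qed

lemma in_D_commute:
  assumes "{x, y} \<subseteq> {ga, ga', gA, gA'} \<or> {x, y} \<subseteq> {gb, gb', gB, gB'}
    \<or> x \<in> {ga, ga'} \<and> y \<in> {gB, gB'} \<or> x \<in> {gb, gb'} \<and> y \<in> {gA, gA'}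
    \<or> y \<in> {ga, ga'} \<and> x \<in> {gB, gB'} \<or> y \<in> {gb, gb'} \<and> x \<in> {gA, gA'}"
  shows "in_D [x, y] = in_D [y, x]"
proof -
  have "(positive_word [x, y], positive_word [y, x]) \<in> D_rel
      \<or> (commutator_word x y, []) \<in> D_rel \<or> (commutator_word y x, []) \<in> D_rel"
    using assms D_rel_mem(2-5)[of x y] D_rel_mem(4,5)[of y x]
    by (elim disjE conjE) (simp_all only: insert_subset simp_thms)
  then show ?thesis
    using in_D_rel in_D_commutator[of x y] in_D_commutator[of y x] by metis
qed

lemma in_D_chain:
  assumes "chain_rel p q r s \<subseteq> D_rel"
  shows "in_D p = in_D s" "in_D q = in_D s" "in_D r = in_D s"
  using assms in_D_rel[of p q] in_D_rel[of q r] in_D_rel[of r s] by (simp_all add: chain_rel_def)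

text \<open>Each chain has four members; orienting it towards the member with two primes turns the chains into
  a terminating set of rewrite rules.\<close>
lemma in_D_chains:
  "in_D [ga, gb] = in_D [ga', gb']" "in_D [gb', ga] = in_D [ga', gb']" "in_D [gb, ga'] = in_D [ga', gb']"
  "in_D [gb, ga] = in_D [gb', ga']" "in_D [ga, gb'] = in_D [gb', ga']" "in_D [ga', gb] = in_D [gb', ga']"
  "in_D [gA, gB] = in_D [gA', gB']" "in_D [gB', gA] = in_D [gA', gB']" "in_D [gB, gA'] = in_D [gA', gB']"
  "in_D [gB, gA] = in_D [gB', gA']" "in_D [gA, gB'] = in_D [gB', gA']" "in_D [gA', gB] = in_D [gB', gA']"
proof -
  have "chain_rel [ga, gb] [gb', ga] [gb, ga'] [ga', gb'] \<subseteq> D_rel"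
    "chain_rel [gb, ga] [ga, gb'] [ga', gb] [gb', ga'] \<subseteq> D_rel"
    "chain_rel [gA, gB] [gB', gA] [gB, gA'] [gA', gB'] \<subseteq> D_rel"
    "chain_rel [gB, gA] [gA, gB'] [gA', gB] [gB', gA'] \<subseteq> D_rel"
    by (rule subsetI, simp only: D_rel_def Un_iff simp_thms)+
  note chains = this[THEN in_D_chain(1)] this[THEN in_D_chain(2)] this[THEN in_D_chain(3)]
  show "in_D [ga, gb] = in_D [ga', gb']" "in_D [gb', ga] = in_D [ga', gb']"
    "in_D [gb, ga'] = in_D [ga', gb']" "in_D [gb, ga] = in_D [gb', ga']"
    "in_D [ga, gb'] = in_D [gb', ga']" "in_D [ga', gb] = in_D [gb', ga']"
    "in_D [gA, gB] = in_D [gA', gB']" "in_D [gB', gA] = in_D [gA', gB']"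
    "in_D [gB, gA'] = in_D [gA', gB']" "in_D [gB, gA] = in_D [gB', gA']"
    "in_D [gA, gB'] = in_D [gB', gA']" "in_D [gA', gB] = in_D [gB', gA']"
    by (rule chains)+
qed

text \<open>With role \<open>Under\<close> the substitution is \<open>\<phi>\<close> and with role \<open>Over\<close> it is \<open>\<psi>\<close>, since \<open>a' = bab\<close> and
  the like hold in \<open>D\<close>. Written on all eight generators they become involutions that commute on the
  nose, which is less visible on the generators \<open>a, b, A, B\<close>.\<close>
fun toggle_prime :: "role \<Rightarrow> gen \<Rightarrow> gen" where
  "toggle_prime Under ga = ga'"
| "toggle_prime Under ga' = ga"
| "toggle_prime Under gb = gb'"
| "toggle_prime Under gb' = gb"
| "toggle_prime Over gA = gA'"
| "toggle_prime Over gA' = gA"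
| "toggle_prime Over gB = gB'"
| "toggle_prime Over gB' = gB"
| "toggle_prime _ x = x"

lemma toggle_prime_involution: "toggle_prime \<rho> (toggle_prime \<rho> x) = x"
  by (cases \<rho>; cases x) simp_all

lemma toggle_prime_commute:
  "toggle_prime \<rho> (toggle_prime \<rho>' x) = toggle_prime \<rho>' (toggle_prime \<rho> x)"
  by (cases \<rho>; cases \<rho>'; cases x) simp_all

text \<open>Squares and commutation relations go to relations of the same kind, as the families
  \<open>{a, a'}\<close>, \<open>{b, b'}\<close>, \<open>{A, A'}\<close>, \<open>{B, B'}\<close> are preserved. Toggling the primes reverses the
  chain \<open>ab = b'a = ba' = a'b'\<close>, and likewise the other chains.\<close>
lemma toggle_prime_respects:
  assumes "(r, s) \<in> D_rel"
  shows "word_eq D_rel (map (apfst (toggle_prime \<rho>)) r) (map (apfst (toggle_prime \<rho>)) s)"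
proof -
  let ?\<sigma> = "toggle_prime \<rho>"
  note chains = in_D_chains[unfolded in_D_def, simplified]
  have chains_toggle: "word_eq D_rel (map (apfst ?\<sigma>) r) (map (apfst ?\<sigma>) s)"
    if "(r, s) \<in> chain_rel [ga, gb] [gb', ga] [gb, ga'] [ga', gb']
        \<union> chain_rel [gb, ga] [ga, gb'] [ga', gb] [gb', ga']
        \<union> chain_rel [gA, gB] [gB', gA] [gB, gA'] [gA', gB']
        \<union> chain_rel [gB, gA] [gA, gB'] [gA', gB] [gB', gA']"
    using that unfolding chain_rel_def word_class_eq_iff[symmetric]
    by (cases \<rho>) (elim UnE insertE emptyE; simp add: chains)+
  have stays: "word_eq D_rel (map (apfst ?\<sigma>) r) (map (apfst ?\<sigma>) s)"
    if "(map (apfst ?\<sigma>) r, map (apfst ?\<sigma>) s) \<in> D_rel"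
    using word_eq_rel[OF that, of "[]" "[]"] by simp
  have families: "x \<in> {ga, ga', gA, gA'} \<Longrightarrow> ?\<sigma> x \<in> {ga, ga', gA, gA'}"
    "x \<in> {gb, gb', gB, gB'} \<Longrightarrow> ?\<sigma> x \<in> {gb, gb', gB, gB'}"
    "x \<in> {ga, ga'} \<Longrightarrow> ?\<sigma> x \<in> {ga, ga'}" "x \<in> {gB, gB'} \<Longrightarrow> ?\<sigma> x \<in> {gB, gB'}"
    "x \<in> {gb, gb'} \<Longrightarrow> ?\<sigma> x \<in> {gb, gb'}" "x \<in> {gA, gA'} \<Longrightarrow> ?\<sigma> x \<in> {gA, gA'}" for x
    by (cases \<rho>; cases x; simp)+
  from assms show ?thesis
  proof (cases rule: D_rel_cases)
    case (square x)
    show ?thesis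
      using D_rel_mem(1)[of "?\<sigma> x"] by (intro stays) (simp add: square)
  next
    case (commute_a x y)
    have "(positive_word [?\<sigma> x, ?\<sigma> y], positive_word [?\<sigma> y, ?\<sigma> x]) \<in> D_rel"
      using families(1)[OF commute_a(3)] families(1)[OF commute_a(4)] by (rule D_rel_mem(2))
    then show ?thesis
      by (intro stays) (simp add: commute_a(1,2))
  next
    case (commute_b x y)
    have "(positive_word [?\<sigma> x, ?\<sigma> y], positive_word [?\<sigma> y, ?\<sigma> x]) \<in> D_rel"
      using families(2)[OF commute_b(3)] families(2)[OF commute_b(4)] by (rule D_rel_mem(3))
    then show ?thesis
      by (intro stays) (simp add: commute_b(1,2))
  next
    case (commutator_aB x y)
    have "(commutator_word (?\<sigma> x) (?\<sigma> y), []) \<in> D_rel"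
      using families(3)[OF commutator_aB(3)] families(4)[OF commutator_aB(4)] by (rule D_rel_mem(4))
    then show ?thesis
      by (intro stays) (simp add: commutator_aB(1,2) commutator_word_def)
  next
    case (commutator_bA x y)
    have "(commutator_word (?\<sigma> x) (?\<sigma> y), []) \<in> D_rel"
      using families(5)[OF commutator_bA(3)] families(6)[OF commutator_bA(4)] by (rule D_rel_mem(5))
    then show ?thesis
      by (intro stays) (simp add: commutator_bA(1,2) commutator_word_def)
  next
    case chain
    then show ?thesis by (rule chains_toggle)
  qed
qed

section \<open>Conjugations and changes of primes\<close>

definition swap_primes :: "role \<Rightarrow> gen word set \<Rightarrow> gen word set" where
  "swap_primes \<rho> = rename_generators (toggle_prime \<rho>) D_rel"

lemma swap_primes_in_D: "swap_primes \<rho> (in_D u) = in_D (map (toggle_prime \<rho>) u)"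
  by (simp add: swap_primes_def in_D_def rename_generators_word_class[OF toggle_prime_respects] comp_def)

lemma swap_primes_iso: "swap_primes \<rho> \<in> iso D D"
  unfolding swap_primes_def D_def
  by (rule rename_generators_iso[OF toggle_prime_respects toggle_prime_involution])

lemma swap_primes_word_class:
  "swap_primes \<rho> (word_class D_rel u) = word_class D_rel (map (apfst (toggle_prime \<rho>)) u)"
  by (simp add: swap_primes_def rename_generators_word_class[OF toggle_prime_respects])

lemma swap_primes_twice:
  assumes "X \<in> carrier D"
  shows "swap_primes \<rho> (swap_primes \<rho> X) = X"
  using assms
  by (auto simp: D_def carrier_presented_group swap_primes_word_class
      map_apfst_involution[OF toggle_prime_involution] simp del: map_map)

lemma swap_primes_commute:
  assumes "X \<in> carrier D"
  shows "swap_primes \<rho> (swap_primes \<rho>' X) = swap_primes \<rho>' (swap_primes \<rho> X)"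
proof -
  have "map (apfst (toggle_prime \<rho>)) (map (apfst (toggle_prime \<rho>')) u)
      = map (apfst (toggle_prime \<rho>')) (map (apfst (toggle_prime \<rho>)) u)" for u :: "gen word"
    by (induction u) (auto simp: toggle_prime_commute[of \<rho> \<rho>'])
  then show ?thesis
    using assms
    by (auto simp: D_def carrier_presented_group swap_primes_word_class simp del: map_map)
qed

lemma swap_primes_closed:
  assumes "X \<in> carrier D"
  shows "swap_primes \<rho> X \<in> carrier D"
  using assms by (auto simp: D_def carrier_presented_group swap_primes_word_class)

lemma in_D_context:
  assumes "in_D u = in_D v"
  shows "in_D (p @ u @ q) = in_D (p @ v @ q)"
  using assms by (simp add: in_D_append)

text \<open>From \<open>ba = a'b\<close> one gets \<open>bab = a'bb = a'\<close>. These identities recognise the substitutions of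
  primes as the prescribed automorphisms.\<close>
lemma in_D_conjugates:
  "in_D [ga'] = in_D [gb, ga, gb]" "in_D [gb'] = in_D [ga, gb, ga]"
  "in_D [gA'] = in_D [gB, gA, gB]" "in_D [gB'] = in_D [gA, gB, gA]"
proof -
  have conjugate: "in_D [x'] = in_D [y, x, y]" if "in_D [y, x] = in_D [x', y]" for x x' y
    using in_D_context[OF that, of "[]" "[y]"] in_D_context[OF in_D_square[of y], of "[x']" "[]"]
    by simp
  show "in_D [ga'] = in_D [gb, ga, gb]" "in_D [gb'] = in_D [ga, gb, ga]"
    "in_D [gA'] = in_D [gB, gA, gB]" "in_D [gB'] = in_D [gA, gB, gA]"
    by (rule conjugate, simp add: in_D_chains)+
qed

lemma is_phi_swap_primes: "is_phi (swap_primes Under)"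
  by (simp add: is_phi_def swap_primes_iso swap_primes_in_D in_D_conjugates flip: in_D_append)

lemma is_psi_swap_primes: "is_psi (swap_primes Over)"
  by (simp add: is_psi_def swap_primes_iso swap_primes_in_D in_D_conjugates flip: in_D_append)

text \<open>The relation of the theorem for a concrete choice of the automorphisms. All of them are
  involutions, so it is symmetric.\<close>
definition D_equiv :: "gen word set \<Rightarrow> gen word set \<Rightarrow> bool" where
  "D_equiv = (conj_or_apply
     {swap_primes Under, swap_primes Over, swap_primes Under \<circ> swap_primes Over})\<^sup>*\<^sup>*"

lemma D_equiv_refl: "D_equiv x x"
  by (simp add: D_equiv_def)

lemma D_equiv_trans: "D_equiv x y \<Longrightarrow> D_equiv y z \<Longrightarrow> D_equiv x z"
  by (simp add: D_equiv_def)

lemma conj_or_apply_sym: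
  assumes involutions: "\<And>f x. f \<in> F \<Longrightarrow> x \<in> carrier D \<Longrightarrow> f x \<in> carrier D \<and> f (f x) = x"
    and "conj_or_apply F x y"
  shows "conj_or_apply F y x"
proof -
  have x: "x \<in> carrier D"
    using assms(2) by (simp add: conj_or_apply_def)
  from assms(2) consider g where "g \<in> carrier D" "y = g \<otimes>\<^bsub>D\<^esub> x \<otimes>\<^bsub>D\<^esub> inv\<^bsub>D\<^esub> g"
    | f where "f \<in> F" "y = f x"
    unfolding conj_or_apply_def by blast
  then show ?thesis
  proof cases
    case 1
    have "inv\<^bsub>D\<^esub> g \<otimes>\<^bsub>D\<^esub> y \<otimes>\<^bsub>D\<^esub> inv\<^bsub>D\<^esub> (inv\<^bsub>D\<^esub> g) = (inv\<^bsub>D\<^esub> g \<otimes>\<^bsub>D\<^esub> g) \<otimes>\<^bsub>D\<^esub> x \<otimes>\<^bsub>D\<^esub> (inv\<^bsub>D\<^esub> g \<otimes>\<^bsub>D\<^esub> g)"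
      using 1 x by (simp only: D.m_assoc D.inv_inv D.inv_closed D.m_closed)
    then have "x = inv\<^bsub>D\<^esub> g \<otimes>\<^bsub>D\<^esub> y \<otimes>\<^bsub>D\<^esub> inv\<^bsub>D\<^esub> (inv\<^bsub>D\<^esub> g)"
      using 1(1) x by simp
    moreover have "y \<in> carrier D"
      using 1 x by simp
    ultimately show ?thesis
      using 1(1) unfolding conj_or_apply_def
      by (intro conjI disjI1 bexI[of _ "inv\<^bsub>D\<^esub> g"]) (assumption | simp)+
  next
    case 2
    then show ?thesis
      using involutions[OF 2(1) x] unfolding conj_or_apply_def by auto
  qed
qed

lemma D_equiv_sym:
  assumes "D_equiv x y"
  shows "D_equiv y x"
proof -
  let ?F = "{swap_primes Under, swap_primes Over, swap_primes Under \<circ> swap_primes Over}"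
  have "f x \<in> carrier D \<and> f (f x) = x" if "f \<in> ?F" "x \<in> carrier D" for f x
    using that swap_primes_commute[of "swap_primes Over x" Over Under]
    by (auto simp: swap_primes_closed swap_primes_twice)
  then have "symp (conj_or_apply ?F)"
    by (intro sympI) (rule conj_or_apply_sym)
  then show ?thesis
    using assms unfolding D_equiv_def by (metis symp_rtranclp sympD)
qed

lemma D_equiv_cyclic: "D_equiv (in_D (u @ v)) (in_D (v @ u))"
proof -
  have "in_D (v @ u) = inv\<^bsub>D\<^esub> (in_D u) \<otimes>\<^bsub>D\<^esub> in_D (u @ v) \<otimes>\<^bsub>D\<^esub> inv\<^bsub>D\<^esub> (inv\<^bsub>D\<^esub> (in_D u))"
    by (simp add: in_D_append in_D_closed D.m_assoc flip: D.m_assoc[of "inv\<^bsub>D\<^esub> (in_D u)"])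
  then show ?thesis
    unfolding D_equiv_def conj_or_apply_def
    by (intro r_into_rtranclp conjI disjI1 bexI) (assumption | simp add: in_D_closed)+
qed

lemma D_equiv_toggle: "D_equiv (in_D u) (in_D (map (toggle_prime \<rho>) u))"
  unfolding D_equiv_def conj_or_apply_def
  by (intro r_into_rtranclp conjI disjI2) (cases \<rho>; simp add: in_D_closed swap_primes_in_D)+

section \<open>Exchanging adjacent letters\<close>

text \<open>The letter of an end as a function of its role, the index of its chord and the presence of a
  prime, detached from the diagram. The empty word stands for an end without a letter.\<close>
definition letter :: "index \<Rightarrow> index \<Rightarrow> role \<Rightarrow> index \<Rightarrow> bool \<Rightarrow> gen list" where
  "letter a b \<rho> i \<pi> =
     (if i = a then [case \<rho> of Under \<Rightarrow> if \<pi> then ga' else ga | Over \<Rightarrow> if \<pi> then gA' else gA]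
      else if i = b then [case \<rho> of Under \<Rightarrow> if \<pi> then gb' else gb | Over \<Rightarrow> if \<pi> then gB' else gB]
      else [])"

lemma letters_eq_letter:
  "letters \<iota> a b c xs e = letter a b (role_of e) (\<iota> (chord_of e)) (primed \<iota> c xs e)"
  by (simp add: letters_def letter_def)

lemma map_toggle_letter:
  "map (toggle_prime \<rho>) (letter a b \<rho>' i \<pi>) = letter a b \<rho>' i (\<pi> \<noteq> (\<rho> = \<rho>'))"
  by (cases \<rho>; cases \<rho>') (simp_all add: letter_def)

lemma index_add_self: "(x :: index) + x = 0"
  by (cases x) (simp add: zero_prod_def)

text \<open>The sum of two of the non-trivial indices is the third, because it differs from \<open>0\<close> and from
  both summands.\<close>
lemma index_cases:
  fixes a b c :: index
  assumes abc: "{a, b, c} = UNIV - {0}"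
  shows "a \<noteq> 0" "b \<noteq> 0" "c \<noteq> 0" "a \<noteq> b" "a \<noteq> c" "b \<noteq> c" "a + b = c" "i \<in> {0, a, b, c}"
proof -
  show nonzero: "a \<noteq> 0" "b \<noteq> 0" "c \<noteq> 0" and all: "i \<in> {0, a, b, c}" for i
    using abc by blast+
  have "UNIV - {0 :: index} = {(0, 1), (1, 0), (1, 1)}"
    by (auto simp: zero_prod_def set_eq_iff split_paired_all)
  then have "card {a, b, c} = 3"
    by (simp add: abc)
  then show distinct: "a \<noteq> b" "a \<noteq> c" "b \<noteq> c"
    by (auto simp: card_insert_if split: if_splits)
  have "a + b \<noteq> 0" 
    using distinct(1) index_add_self[of b] by (metis add.assoc add.left_neutral add.right_neutral)
  then show "a + b = c"
    using all[of "a + b"] nonzero by auto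
qed

text \<open>The relations of \<open>D\<close> among letters of the same role are made for this purpose: if two adjacent ends of the same role exchange
  places and have indices \<open>a\<close> and \<open>b\<close>, one of the two letters changes its prime (\<open>ab = b'a\<close>, \<open>ba = a'b\<close>
  and so on); otherwise the letters commute unchanged. If \<open>i + j = c\<close> for
  any other indices, both ends are without letters. In a third move the condition \<open>i + j = c\<close> says that the
  third chord has index \<open>c\<close>.\<close>
lemma letter_exchange:
  assumes abc: "{a, b, c} = UNIV - {0}"
  shows "in_D (letter a b \<rho> i \<pi> @ letter a b \<rho> j \<pi>')
    = in_D (letter a b \<rho> j \<pi>' @ letter a b \<rho> i (\<pi> \<noteq> (i + j = c)))"
proof -
  note index = index_cases[OF abc]
  have ba: "b + a = c"
    using index(7) by (simp add: add.commute)
  have empty: "letter a b \<rho> i \<pi> = []" if "i \<notin> {a, b}" for i \<pi>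
    using that by (simp add: letter_def)
  consider "i \<notin> {a, b}" | "j \<notin> {a, b}" "i \<in> {a, b}" | "i \<in> {a, b}" "j = i" | "i = a" "j = b" | "i = b" "j = a"
    by blast
  then show ?thesis
  proof cases
    case 1
    then show ?thesis by (simp add: empty)
  next
    case 2
    then have "i + j \<noteq> c"
      using index_cases(8)[OF abc, of j] index(1-6) \<open>a + b = c\<close> ba by auto
    with 2 show ?thesis by (simp add: empty)
  next
    case 3
    then have "i + j \<noteq> c"
      using index(3) by (auto simp: index_add_self)
    with 3 show ?thesis
      by (cases \<rho>) (auto simp: letter_def in_D_commute)
  next
    case 4
    then show ?thesis
      using index(4,7) by (cases \<rho>; cases \<pi>; cases \<pi>') (simp_all add: letter_def in_D_chains)
  next
    case 5
    then show ?thesis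
      using index(4) ba by (cases \<rho>; cases \<pi>; cases \<pi>') (simp_all add: letter_def in_D_chains)
  qed
qed

text \<open>Every lower-case letter commutes with every capital letter: an \<open>a\<close> and an \<open>A\<close> as members of a
  commuting family, an \<open>a\<close> and a \<open>B\<close> by a commutator relation.\<close>
lemma letter_commute:
  "in_D (letter a b Under i \<pi> @ letter a b Over j \<pi>')
    = in_D (letter a b Over j \<pi>' @ letter a b Under i \<pi>)"
  by (simp add: letter_def in_D_commute)

section \<open>Counting chord ends\<close>

lemma opposite_simps [simp]:
  "chord_of (opposite e) = chord_of e" "role_of (opposite e) = other_role (role_of e)"
  "positive (opposite e) = positive e" "opposite (opposite e) = e" "opposite e \<noteq> e"
proof -
  have "other_role (other_role \<rho>) = \<rho>" "other_role \<rho> \<noteq> \<rho>" for \<rho>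
    by (cases \<rho>; simp)+
  then show "chord_of (opposite e) = chord_of e" "role_of (opposite e) = other_role (role_of e)"
    "positive (opposite e) = positive e" "opposite (opposite e) = e" "opposite e \<noteq> e"
    by (auto simp: opposite_def chord_end.expand) (metis chord_end.sel(2))
qed

lemma other_role_neq [simp]: "other_role \<rho> \<noteq> \<rho>" "\<rho> \<noteq> other_role \<rho>"
  by (cases \<rho>; simp)+

text \<open>The number of ends of index \<open>c\<close> in a given role; its parity on an initial segment decides about
  primes.\<close>
definition end_count :: "('c \<Rightarrow> index) \<Rightarrow> index \<Rightarrow> role \<Rightarrow> 'c long_diagram \<Rightarrow> nat" where
  "end_count \<iota> c \<rho> xs = length (filter (\<lambda>f. role_of f = \<rho> \<and> \<iota> (chord_of f) = c) xs)"

lemma end_count_simps [simp]: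
  "end_count \<iota> c \<rho> [] = 0"
  "end_count \<iota> c \<rho> (e # xs) = (if role_of e = \<rho> \<and> \<iota> (chord_of e) = c then 1 else 0) + end_count \<iota> c \<rho> xs"
  "end_count \<iota> c \<rho> (xs @ ys) = end_count \<iota> c \<rho> xs + end_count \<iota> c \<rho> ys"
  by (simp_all add: end_count_def)

abbreviation before :: "'a \<Rightarrow> 'a list \<Rightarrow> 'a list" where
  "before g \<equiv> takeWhile (\<lambda>f. f \<noteq> g)"

lemma primed_iff: "primed \<iota> c xs e \<longleftrightarrow> odd (end_count \<iota> c (role_of e) (before (opposite e) xs))"
  by (simp add: primed_def end_count_def)

lemma before_append: "before g (xs @ ys) = (if g \<in> set xs then before g xs else xs @ before g ys)"
  by (induction xs) auto

lemma before_absent: "g \<notin> set xs \<Longrightarrow> before g xs = xs"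
  by (induction xs) auto

text \<open>The letters depend on the whole diagram, the word is read off segment by segment. Separating the
  diagram \<open>xs\<close> from the segment \<open>ys\<close> lets the word be cut along the pieces on which a move acts.\<close>
definition word_part ::
    "('c \<Rightarrow> index) \<Rightarrow> index \<Rightarrow> index \<Rightarrow> index \<Rightarrow> 'c long_diagram \<Rightarrow> 'c long_diagram \<Rightarrow> gen list" where
  "word_part \<iota> a b c xs ys = concat (map (letters \<iota> a b c xs) ys)"

lemma word_part_simps [simp]:
  "word_part \<iota> a b c xs [] = []"
  "word_part \<iota> a b c xs (e # ys) = letters \<iota> a b c xs e @ word_part \<iota> a b c xs ys"
  "word_part \<iota> a b c xs (ys @ zs) = word_part \<iota> a b c xs ys @ word_part \<iota> a b c xs zs"
  by (simp_all add: word_part_def)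

lemma w_eq: "w \<iota> a b c xs = in_D (word_part \<iota> a b c xs xs)"
  by (simp add: w_def w_word_def word_part_def)

lemma word_part_cong:
  assumes "\<And>e. e \<in> set ys \<Longrightarrow> primed \<iota> c xs' e = primed \<iota> c xs e"
  shows "word_part \<iota> a b c xs' ys = word_part \<iota> a b c xs ys"
  unfolding word_part_def using assms by (intro arg_cong[of _ _ concat] map_cong) (simp_all add: letters_eq_letter)

lemma w_cong_index:
  assumes "\<And>d. d \<in> chord_of ` set xs \<Longrightarrow> \<iota>' d = \<iota> d"
  shows "w \<iota>' a b c xs = w \<iota> a b c xs"
proof -
  have "primed \<iota>' c xs e = primed \<iota> c xs e" for e
  proof -
    have "filter (\<lambda>f. role_of f = role_of e \<and> \<iota>' (chord_of f) = c) (before (opposite e) xs)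
      = filter (\<lambda>f. role_of f = role_of e \<and> \<iota> (chord_of f) = c) (before (opposite e) xs)"
      using assms by (intro filter_cong) (auto dest: set_takeWhileD)
    then show ?thesis
      by (simp add: primed_def)
  qed
  then show ?thesis
    using assms by (auto simp: w_def w_word_def letters_eq_letter intro!: arg_cong[of _ _ in_D] arg_cong[of _ _ concat])
qed

section \<open>Cuts of a Gauss diagram\<close>

lemma distinct_long_diagram: "long_gauss_diagram xs \<Longrightarrow> distinct xs"
  by (simp add: long_gauss_diagram_def)

lemma opposite_in_long_diagram:
  "long_gauss_diagram xs \<Longrightarrow> e \<in> set xs \<Longrightarrow> opposite e \<in> set xs"
  by (simp add: long_gauss_diagram_def)

lemma chord_cases:
  assumes "long_gauss_diagram xs" "e \<in> set xs" "f \<in> set xs" "chord_of e = chord_of f"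
  shows "f = e \<or> f = opposite e"
  using assms by (auto simp: long_gauss_diagram_def)

lemma set_closure_diagram: "ys \<in> closure_diagram xs \<Longrightarrow> set ys = set xs"
  by (auto simp: closure_diagram_def)

lemma self_in_closure: "xs \<in> closure_diagram xs"
  using rotate0 by (auto simp: closure_diagram_def intro: range_eqI[of _ _ 0])

lemma closure_diagram_sym:
  assumes "ys \<in> closure_diagram xs"
  shows "xs \<in> closure_diagram ys"
proof -
  obtain n where n: "ys = rotate n xs"
    using assms by (auto simp: closure_diagram_def)
  have "rotate (length xs - n mod length xs) ys = rotate (length xs - n mod length xs + n mod length xs) xs"
    unfolding n by (metis rotate_conv_mod rotate_rotate)
  also have "\<dots> = xs"
    by (cases "xs = []") (simp_all add: less_imp_le)
  finally show ?thesis
    by (metis closure_diagram_def rangeI)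
qed

lemma long_gauss_diagram_rotation:
  assumes "long_gauss_diagram xs" "ys \<in> closure_diagram xs"
  shows "long_gauss_diagram ys"
proof -
  obtain n where "ys = rotate n xs"
    using assms(2) by (auto simp: closure_diagram_def)
  then show ?thesis
    using assms(1) by (simp add: long_gauss_diagram_def)
qed

lemma gauss_diagram_closure_iff: "gauss_diagram (closure_diagram xs) \<longleftrightarrow> long_gauss_diagram xs"
  unfolding gauss_diagram_def
  using self_in_closure long_gauss_diagram_rotation by metis

lemma chords_closure: "chords (closure_diagram xs) = chord_of ` set xs"
  by (simp add: chords_def closure_diagram_def)

definition chord_count :: "('c diagram \<Rightarrow> 'c \<Rightarrow> index) \<Rightarrow> index \<Rightarrow> 'c diagram \<Rightarrow> nat" where
  "chord_count ind c G = card {d \<in> chords G. ind G d = c}"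

text \<open>Every chord has exactly one end of each role, so the count does not depend on the role, the order of
  the ends or the reference point.\<close>
lemma end_count_eq_card:
  assumes "long_gauss_diagram xs"
  shows "end_count \<iota> c \<rho> xs = card {d \<in> chord_of ` set xs. \<iota> d = c}"
proof -
  let ?E = "{f \<in> set xs. role_of f = \<rho> \<and> \<iota> (chord_of f) = c}"
  have "end_count \<iota> c \<rho> xs = card ?E"
    using distinct_long_diagram[OF assms]
      distinct_card[of "filter (\<lambda>f. role_of f = \<rho> \<and> \<iota> (chord_of f) = c) xs"]
    by (simp add: end_count_def)
  also have "\<dots> = card (chord_of ` ?E)"
  proof (rule card_image[symmetric], rule inj_onI)
    fix e f assume ef: "e \<in> ?E" "f \<in> ?E" "chord_of e = chord_of f"
    then have "f = e \<or> f = opposite e"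
      by (intro chord_cases[OF assms]) simp_all
    moreover have "f \<noteq> opposite e"
      using ef by (metis (mono_tags, lifting) mem_Collect_eq opposite_simps(2) other_role_neq(1))
    ultimately show "e = f"
      by simp
  qed
  also have "chord_of ` ?E = {d \<in> chord_of ` set xs. \<iota> d = c}"
  proof (intro equalityI subsetI)
    fix d assume "d \<in> {d \<in> chord_of ` set xs. \<iota> d = c}"
    then obtain e where e: "e \<in> set xs" "d = chord_of e" "\<iota> d = c"
      by auto
    moreover have "opposite e \<in> set xs"
      by (rule opposite_in_long_diagram[OF assms e(1)])
    moreover have "role_of e = \<rho> \<or> role_of (opposite e) = \<rho>"
      by (cases \<rho>; cases "role_of e") simp_all
    ultimately obtain f where "f \<in> {e, opposite e}" "f \<in> set xs" "role_of f = \<rho>"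
      by blast
    then show "d \<in> chord_of ` ?E"
      using e(2,3) by (intro image_eqI[of _ _ f]) auto
  qed auto
  finally show ?thesis .
qed

section \<open>Moving the reference point\<close>

text \<open>If \<open>e\<close> has index \<open>c\<close>, then moving it from the front to the end of the line lowers by one every count of
  ends of its role and so toggles all primes at ends of this role. The only end whose count could
  behave differently is the one opposite to \<open>e\<close>: its count goes from zero to the number of all ends of
  index \<open>c\<close> of the role opposite to that of \<open>e\<close>, and here evenness is used.\<close>
lemma primed_rotate1:
  assumes gauss: "long_gauss_diagram (e # xs)"
    and even: "\<And>\<rho>. even (end_count \<iota> c \<rho> (e # xs))"
    and "f \<in> set (e # xs)"
  shows "primed \<iota> c (xs @ [e]) f \<longleftrightarrow> primed \<iota> c (e # xs) f \<noteq> (role_of e = role_of f \<and> \<iota> (chord_of e) = c)"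
proof -
  have opp: "opposite f \<in> set (e # xs)" and e: "e \<notin> set xs"
    using opposite_in_long_diagram[OF gauss] distinct_long_diagram[OF gauss] assms(3) by auto
  show ?thesis
  proof (cases "opposite f = e")
    case True
    then have "role_of e \<noteq> role_of f"
      by (metis opposite_simps(2) other_role_neq(1))
    then show ?thesis
      using even[of "role_of f"] e by (simp add: primed_iff True before_append before_absent)
  next
    case False
    then show ?thesis
      using opp by (auto simp: primed_iff before_append)
  qed
qed

text \<open>If \<open>e\<close> has index \<open>c\<close>, it has no letter and its passage applies \<open>\<phi>\<close> or \<open>\<psi>\<close>; otherwise no prime changes
  and its letter goes from the front of the word to its end, which is a conjugation.\<close>
lemma w_rotate1:
  assumes abc: "{a, b, c} = UNIV - {0}"
    and gauss: "long_gauss_diagram (e # xs)"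
    and even: "\<And>\<rho>. even (end_count \<iota> c \<rho> (e # xs))"
  shows "D_equiv (w \<iota> a b c (e # xs)) (w \<iota> a b c (xs @ [e]))"
proof (cases "\<iota> (chord_of e) = c")
  case True
  have e: "letters \<iota> a b c ys e = []" for ys
    using index_cases(5,6)[OF abc] True by (simp add: letters_eq_letter letter_def)
  have "letters \<iota> a b c (xs @ [e]) f = map (toggle_prime (role_of e)) (letters \<iota> a b c (e # xs) f)"
    if "f \<in> set xs" for f
    using primed_rotate1[OF gauss even, of f] that True by (simp add: letters_eq_letter map_toggle_letter)
  then have "word_part \<iota> a b c (xs @ [e]) xs = map (toggle_prime (role_of e)) (word_part \<iota> a b c (e # xs) xs)"
    unfolding word_part_def map_concat by (intro arg_cong[of _ _ concat]) simp
  then show ?thesis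
    by (simp add: w_eq e D_equiv_toggle)
next
  case False
  have "word_part \<iota> a b c (xs @ [e]) ys = word_part \<iota> a b c (e # xs) ys" if "set ys \<subseteq> set (e # xs)" for ys
    by (rule word_part_cong) (use primed_rotate1[OF gauss even] that False in auto)
  from this[of xs] this[of "[e]"] show ?thesis
    by (simp add: w_eq D_equiv_cyclic subset_insertI)
qed

lemma w_rotate:
  assumes abc: "{a, b, c} = UNIV - {0}"
    and gauss: "long_gauss_diagram xs"
    and even: "\<And>\<rho>. even (end_count \<iota> c \<rho> xs)"
    and "ys \<in> closure_diagram xs"
  shows "D_equiv (w \<iota> a b c xs) (w \<iota> a b c ys)"
proof -
  have "D_equiv (w \<iota> a b c xs) (w \<iota> a b c (rotate n xs))" for n
  proof (induction n)
    case (Suc n)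
    let ?ys = "rotate n xs"
    have rotated: "?ys \<in> closure_diagram xs"
      by (simp add: closure_diagram_def)
    then have gauss': "long_gauss_diagram ?ys"
      by (rule long_gauss_diagram_rotation[OF gauss])
    have even': "even (end_count \<iota> c \<rho> ?ys)" for \<rho>
      using even[of \<rho>] set_closure_diagram[OF rotated]
      by (simp add: end_count_eq_card gauss gauss')
    have "D_equiv (w \<iota> a b c ?ys) (w \<iota> a b c (rotate1 ?ys))"
    proof (cases ?ys)
      case (Cons e zs)
      then show ?thesis
        using w_rotate1[OF abc, of e zs \<iota>] gauss' even' by simp
    qed (simp add: D_equiv_refl)
    with Suc show ?case
      by (auto intro: D_equiv_trans)
  qed (simp add: D_equiv_refl)
  then show ?thesis
    using assms(4) by (auto simp: closure_diagram_def)
qed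

section \<open>Words under Reidemeister moves\<close>

lemma opposite_eq_simps [simp]: "opposite e = opposite f \<longleftrightarrow> e = f" "e \<noteq> opposite e"
  by (metis opposite_simps(4,5))+

text \<open>The two ends of a chord of trivial index have no letters and are never counted.\<close>
lemma w_reidemeister1:
  assumes abc: "{a, b, c} = UNIV - {0}"
    and gauss: "long_gauss_diagram u" and gauss': "long_gauss_diagram ([e, opposite e] @ u)"
    and trivial: "\<iota> (chord_of e) = 0"
  shows "w \<iota> a b c u = w \<iota> a b c ([e, opposite e] @ u)"
proof -
  note index = index_cases(1-3)[OF abc]
  let ?xs = "[e, opposite e] @ u"
  have "primed \<iota> c ?xs f = primed \<iota> c u f" if "f \<in> set u" for f
  proof -
    have "opposite f \<noteq> e" "opposite f \<noteq> opposite e"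
      using opposite_in_long_diagram[OF gauss that] distinct_long_diagram[OF gauss'] by auto
    then show ?thesis
      using index(3) trivial by (auto simp: primed_iff)
  qed
  then have "word_part \<iota> a b c ?xs u = word_part \<iota> a b c u u"
    by (rule word_part_cong)
  moreover have "letters \<iota> a b c ?xs f = []" if "chord_of f = chord_of e" for f
    using that trivial index by (simp add: letters_eq_letter letter_def)
  ultimately show ?thesis
    by (simp add: w_eq)
qed

lemma letter_square: "in_D (letter a b \<rho> i \<pi> @ letter a b \<rho> i \<pi>) = in_D []"
  by (simp add: letter_def in_D_square)

text \<open>Both over-ends of the two chords see the same counts, so they give the same letter twice, and the same
  holds for the under-ends; squares vanish in \<open>D\<close>. For any other end the two new chords are counted both
  or not at all on each of the two segments.\<close>
lemma w_reidemeister2: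
  assumes gauss: "long_gauss_diagram (u @ v)"
    and layout: "xs = [x, y] @ u @ m @ v" "m = [opposite x, opposite y] \<or> m = [opposite y, opposite x]"
    and gauss': "long_gauss_diagram xs"
    and roles: "role_of x = Over" "role_of y = Over"
    and equal: "\<iota> (chord_of x) = \<iota> (chord_of y)"
  shows "w \<iota> a b c (u @ v) = w \<iota> a b c xs"
proof -
  have distinct: "distinct xs"
    by (rule distinct_long_diagram[OF gauss'])
  have "primed \<iota> c xs f = primed \<iota> c (u @ v) f" if "f \<in> set (u @ v)" for f
  proof -
    have "opposite f \<in> set (u @ v)"
      by (rule opposite_in_long_diagram[OF gauss that])
    then have "opposite f \<noteq> x" "opposite f \<noteq> y" "opposite f \<notin> set m"
      using distinct layout by auto
    then show ?thesis
      using layout(2) roles equal unfolding layout(1)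
      by (auto simp: primed_iff before_append)
  qed
  then have rest: "word_part \<iota> a b c xs ys = word_part \<iota> a b c (u @ v) ys" if "set ys \<subseteq> set (u @ v)" for ys
    using that by (intro word_part_cong) auto
  have "x \<noteq> opposite y" "y \<noteq> opposite x"
    using roles by (metis opposite_simps(2) other_role_neq(1))+
  moreover have "x \<noteq> y" "opposite x \<notin> set u" "opposite y \<notin> set u"
    using distinct layout by auto
  ultimately have primed_xy: "primed \<iota> c xs x = primed \<iota> c xs y"
    using layout(2) roles unfolding layout(1)
    by (elim disjE) (simp_all add: primed_iff before_append)
  \<comment> \<open>The opposite ends open the diagram, and they are over-ends, so nothing is counted before them.\<close>
  have primed_oxy: "\<not> primed \<iota> c xs (opposite x)" "\<not> primed \<iota> c xs (opposite y)"
    using roles unfolding layout(1) by (simp_all add: primed_iff)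
  have "in_D (word_part \<iota> a b c xs [x, y]) = in_D []"
    using roles equal primed_xy by (simp add: letters_eq_letter letter_square)
  moreover have "in_D (word_part \<iota> a b c xs m) = in_D []"
    using layout(2) roles equal primed_oxy by (auto simp: letters_eq_letter letter_square)
  moreover have "word_part \<iota> a b c xs xs
      = word_part \<iota> a b c xs [x, y] @ word_part \<iota> a b c xs u @ word_part \<iota> a b c xs m @ word_part \<iota> a b c xs v"
    unfolding layout(1) by simp
  moreover have "in_D (X @ U @ M @ V) = in_D (U @ V)" if "in_D X = in_D []" "in_D M = in_D []" for X U M V
    using in_D_context[OF that(1), of "[]" "U @ M @ V"] in_D_context[OF that(2), of U V] by simp
  ultimately have "w \<iota> a b c xs = in_D (word_part \<iota> a b c xs u @ word_part \<iota> a b c xs v)"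
    by (simp only: w_eq)
  then show ?thesis
    using rest[of u] rest[of v] by (simp add: w_eq)
qed

text \<open>Exchanging two neighbours changes the set of ends before \<open>g\<close> only if \<open>g\<close> is one of them, and then
  exactly by the other one.\<close>
lemma odd_end_count_exchange:
  fixes \<iota> c \<rho> g
  defines "N \<equiv> \<lambda>xs. end_count \<iota> c \<rho> (before g xs)"
    and "counted \<equiv> \<lambda>f. role_of f = \<rho> \<and> \<iota> (chord_of f) = c"
  assumes "distinct (P @ ordered_pair t x y @ S)"
  shows "odd (N (P @ ordered_pair (\<not> t) x y @ S)) \<longleftrightarrow>
    odd (N (P @ ordered_pair t x y @ S)) \<noteq> (g = x \<and> counted y \<or> g = y \<and> counted x)"
  using assms(3) by (cases t) (auto simp: N_def counted_def ordered_pair_def before_append)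

lemma set_ordered_pair [simp]: "set (ordered_pair t x y) = {x, y}"
  by (auto simp: ordered_pair_def)

lemma distinct_ordered_pair [simp]: "distinct (ordered_pair t x y) \<longleftrightarrow> x \<noteq> y"
  by (auto simp: ordered_pair_def)

text \<open>Three disjoint exchanges, as they occur in a third move. As \<open>g\<close> lies in at most one of the pairs, at
  most one of the three changes takes place, and disjunction replaces the sum modulo two.\<close>
lemma odd_end_count_exchange3:
  fixes \<iota> c \<rho> g
  defines "N \<equiv> \<lambda>xs. end_count \<iota> c \<rho> (before g xs)"
    and "counted \<equiv> \<lambda>f. role_of f = \<rho> \<and> \<iota> (chord_of f) = c"
  defines "passed \<equiv> \<lambda>x y. g = x \<and> counted y \<or> g = y \<and> counted x"
  assumes distinct: "distinct (ordered_pair t1 x1 y1 @ u @ ordered_pair t2 x2 y2 @ v @ ordered_pair t3 x3 y3 @ s)"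
  shows "odd (N (ordered_pair (\<not> t1) x1 y1 @ u @ ordered_pair (\<not> t2) x2 y2 @ v @ ordered_pair (\<not> t3) x3 y3 @ s))
    \<longleftrightarrow> odd (N (ordered_pair t1 x1 y1 @ u @ ordered_pair t2 x2 y2 @ v @ ordered_pair t3 x3 y3 @ s))
      \<noteq> (passed x1 y1 \<or> passed x2 y2 \<or> passed x3 y3)"
proof -
  have "odd (N ([] @ ordered_pair (\<not> t1) x1 y1 @ u @ ordered_pair t2 x2 y2 @ v @ ordered_pair t3 x3 y3 @ s))
    \<longleftrightarrow> odd (N ([] @ ordered_pair t1 x1 y1 @ u @ ordered_pair t2 x2 y2 @ v @ ordered_pair t3 x3 y3 @ s)) \<noteq> passed x1 y1"
    unfolding N_def passed_def counted_def
    by (rule odd_end_count_exchange) (use distinct in simp)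
  moreover have "odd (N ((ordered_pair (\<not> t1) x1 y1 @ u) @ ordered_pair (\<not> t2) x2 y2 @ v @ ordered_pair t3 x3 y3 @ s))
    \<longleftrightarrow> odd (N ((ordered_pair (\<not> t1) x1 y1 @ u) @ ordered_pair t2 x2 y2 @ v @ ordered_pair t3 x3 y3 @ s)) \<noteq> passed x2 y2"
    unfolding N_def passed_def counted_def
    by (rule odd_end_count_exchange) (use distinct in auto)
  moreover have "odd (N ((ordered_pair (\<not> t1) x1 y1 @ u @ ordered_pair (\<not> t2) x2 y2 @ v) @ ordered_pair (\<not> t3) x3 y3 @ s))
    \<longleftrightarrow> odd (N ((ordered_pair (\<not> t1) x1 y1 @ u @ ordered_pair (\<not> t2) x2 y2 @ v) @ ordered_pair t3 x3 y3 @ s)) \<noteq> passed x3 y3"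
    unfolding N_def passed_def counted_def
    by (rule odd_end_count_exchange) (use distinct in auto)
  moreover have "\<not> (passed x1 y1 \<and> passed x2 y2)" "\<not> (passed x1 y1 \<and> passed x3 y3)" "\<not> (passed x2 y2 \<and> passed x3 y3)"
    using distinct by (auto simp: passed_def)
  ultimately show ?thesis
    by auto
qed

lemma in_D_pair_exchange:
  assumes "in_D (word_part \<iota> a b c xs [x, y]) = in_D (word_part \<iota> a b c xs' [y, x])"
    and "in_D (word_part \<iota> a b c xs [y, x]) = in_D (word_part \<iota> a b c xs' [x, y])"
  shows "in_D (word_part \<iota> a b c xs (ordered_pair t x y)) = in_D (word_part \<iota> a b c xs' (ordered_pair (\<not> t) x y))"
  using assms by (simp add: ordered_pair_def)

lemma index_sum_zeroD:
  fixes i j k :: index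
  assumes "i + j + k = 0"
  shows "i + j = k"
proof -
  have "i + j = i + j + k + k"
    by (simp add: add.assoc index_add_self)
  then show ?thesis
    by (simp add: assms)
qed

lemma neq_opposite_same_role:
  assumes "role_of e = role_of f"
  shows "e \<noteq> opposite f" "opposite e \<noteq> f"
  using assms by (metis opposite_simps(2) other_role_neq(1))+

text \<open>The prime of \<open>e\<close> depends on ends of the role of \<open>e\<close> before the end opposite to \<open>e\<close>, that is, on ends of the
  role other than that of \<open>opposite e\<close>. Hence an exchange of two ends of the same role affects no prime.\<close>
lemma not_passed_same_role:
  assumes "role_of f = role_of g"
  shows "\<not> (opposite e = f \<and> role_of g = role_of e \<and> P \<or> opposite e = g \<and> role_of f = role_of e \<and> Q)"
  using assms by (metis opposite_simps(2) other_role_neq(1))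

lemma passed_other_role:
  assumes "role_of g = other_role (role_of f)"
  shows "opposite e = f \<and> role_of g = role_of e \<and> P \<or> opposite e = g \<and> role_of f = role_of e \<and> Q
    \<longleftrightarrow> e = opposite f \<and> P \<or> e = opposite g \<and> Q"
  using assms by (metis opposite_simps(2,4))

text \<open>Of the three exchanges only the one of an over-end with an under-end, on the middle strand, affects
  primes: the prime at \<open>x\<close> changes if \<open>z\<close> has index \<open>c\<close>, the prime at \<open>opposite z\<close> if \<open>x\<close> has index \<open>c\<close>. Since
  the indices sum to zero, these are exactly the changes that letting the letters of the top strand
  (\<open>x\<close>, \<open>y\<close>) and those of the bottom strand (\<open>opposite z\<close>, \<open>opposite y\<close>) pass each other requires in \<open>D\<close>.
  On the middle strand a lower-case and a capital letter exchange places.\<close>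
lemma w_reidemeister3:
  fixes \<iota> :: "'c \<Rightarrow> index"
  assumes abc: "{a, b, c} = UNIV - {0}"
    and roles: "role_of x = Over" "role_of y = Over" "role_of z = Over"
    and top_ends: "top_ends = (\<lambda>t. ordered_pair t x y)"
    and middle_ends: "middle_ends = (\<lambda>t. ordered_pair t (opposite x) z)"
    and bottom_ends: "bottom_ends = (\<lambda>t. ordered_pair t (opposite y) (opposite z))"
    and layout: "xs = top_ends tT @ u @ middle_ends tM @ v @ bottom_ends tB @ s
        \<and> xs' = top_ends (\<not> tT) @ u @ middle_ends (\<not> tM) @ v @ bottom_ends (\<not> tB) @ s
      \<or> xs = top_ends tT @ u @ bottom_ends tB @ v @ middle_ends tM @ s
        \<and> xs' = top_ends (\<not> tT) @ u @ bottom_ends (\<not> tB) @ v @ middle_ends (\<not> tM) @ s"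
    and gauss: "long_gauss_diagram xs"
    and sum: "\<iota> (chord_of x) + \<iota> (chord_of y) + \<iota> (chord_of z) = 0"
  shows "w \<iota> a b c xs = w \<iota> a b c xs'"
proof -
  let ?i = "\<lambda>e. \<iota> (chord_of e)"
  have distinct: "distinct xs"
    by (rule distinct_long_diagram[OF gauss])
  have xz: "x \<noteq> z"
    using distinct layout by (auto simp: top_ends middle_ends bottom_ends)
  have toggled: "primed \<iota> c xs' e \<longleftrightarrow>
      primed \<iota> c xs e \<noteq> (e = x \<and> ?i z = c \<or> e = opposite z \<and> ?i x = c)" for e
  proof -
    have passed:
      "\<not> (opposite e = x \<and> role_of y = role_of e \<and> P \<or> opposite e = y \<and> role_of x = role_of e \<and> Q)"
      "\<not> (opposite e = opposite y \<and> role_of (opposite z) = role_of e \<and> P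
        \<or> opposite e = opposite z \<and> role_of (opposite y) = role_of e \<and> Q)"
      "opposite e = opposite x \<and> role_of z = role_of e \<and> P
        \<or> opposite e = z \<and> role_of (opposite x) = role_of e \<and> Q
        \<longleftrightarrow> e = x \<and> P \<or> e = opposite z \<and> Q" for P Q
      using not_passed_same_role[of x y e P Q] not_passed_same_role[of "opposite y" "opposite z" e P Q]
        passed_other_role[of z "opposite x" e P Q] roles
      by simp_all
    show ?thesis
      using layout
    proof (elim disjE conjE)
      assume xs: "xs = top_ends tT @ u @ middle_ends tM @ v @ bottom_ends tB @ s"
        "xs' = top_ends (\<not> tT) @ u @ middle_ends (\<not> tM) @ v @ bottom_ends (\<not> tB) @ s"
      show ?thesis
        using odd_end_count_exchange3[OF distinct[unfolded xs(1) top_ends middle_ends bottom_ends],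
            of \<iota> c "role_of e" "opposite e"]
        by (simp only: primed_iff xs top_ends middle_ends bottom_ends passed opposite_simps(1) simp_thms)
    next
      assume xs: "xs = top_ends tT @ u @ bottom_ends tB @ v @ middle_ends tM @ s"
        "xs' = top_ends (\<not> tT) @ u @ bottom_ends (\<not> tB) @ v @ middle_ends (\<not> tM) @ s"
      show ?thesis
        using odd_end_count_exchange3[OF distinct[unfolded xs(1) top_ends middle_ends bottom_ends],
            of \<iota> c "role_of e" "opposite e"]
        by (simp only: primed_iff xs top_ends middle_ends bottom_ends passed opposite_simps(1) simp_thms)
    qed
  qed
  have xy: "x \<noteq> y" "y \<noteq> z"
    using distinct layout by (auto simp: top_ends middle_ends bottom_ends)
  have toggle_twice: "((\<pi> \<noteq> t) \<noteq> t) = \<pi>" for \<pi> t :: bool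
    by blast
  have over_under: "x \<noteq> opposite z" "y \<noteq> opposite z" "opposite z \<noteq> x" "opposite y \<noteq> x"
    using roles by (simp_all add: neq_opposite_same_role)
  have "?i z + ?i y + ?i x = 0"
    using sum by (simp only: ac_simps)
  then have sums: "?i x + ?i y = ?i z" "?i z + ?i y = ?i x"
    using sum by (blast intro: index_sum_zeroD)+
  have "in_D (word_part \<iota> a b c xs (top_ends t)) = in_D (word_part \<iota> a b c xs' (top_ends (\<not> t)))" for t
  proof -
    let ?X = "letter a b Over (?i x)" and ?Y = "letter a b Over (?i y) (primed \<iota> c xs y)"
    have "in_D (?X \<pi> @ ?Y) = in_D (?Y @ ?X (\<pi> \<noteq> (?i z = c)))" for \<pi>
      using letter_exchange[OF abc, of Over "?i x" \<pi> "?i y"] by (simp add: sums(1))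
    note exchange = this[of "primed \<iota> c xs x"]
      this[of "primed \<iota> c xs x \<noteq> (?i z = c)", unfolded toggle_twice]
    have "letters \<iota> a b c xs' x = ?X (primed \<iota> c xs x \<noteq> (?i z = c))"
      "letters \<iota> a b c xs x = ?X (primed \<iota> c xs x)"
      "letters \<iota> a b c xs' y = ?Y" "letters \<iota> a b c xs y = ?Y"
      using xy over_under by (simp_all add: letters_eq_letter toggled roles)
    note letters = this
    show ?thesis
      unfolding top_ends
      by (rule in_D_pair_exchange) (simp_all only: word_part_simps append_Nil2 letters exchange)
  qed
  moreover have "in_D (word_part \<iota> a b c xs (bottom_ends t)) = in_D (word_part \<iota> a b c xs' (bottom_ends (\<not> t)))" for t
  proof -
    let ?Z = "letter a b Under (?i z)" and ?Y = "letter a b Under (?i y) (primed \<iota> c xs (opposite y))"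
    have "in_D (?Z \<pi> @ ?Y) = in_D (?Y @ ?Z (\<pi> \<noteq> (?i x = c)))" for \<pi>
      using letter_exchange[OF abc, of Under "?i z" \<pi> "?i y"] by (simp add: sums(2))
    note exchange = this[of "primed \<iota> c xs (opposite z)"]
      this[of "primed \<iota> c xs (opposite z) \<noteq> (?i x = c)", unfolded toggle_twice]
    have "letters \<iota> a b c xs' (opposite z) = ?Z (primed \<iota> c xs (opposite z) \<noteq> (?i x = c))"
      "letters \<iota> a b c xs (opposite z) = ?Z (primed \<iota> c xs (opposite z))"
      "letters \<iota> a b c xs' (opposite y) = ?Y" "letters \<iota> a b c xs (opposite y) = ?Y"
      using xy over_under by (simp_all add: letters_eq_letter toggled roles)
    note letters = this
    show ?thesis
      unfolding bottom_ends
      by (rule in_D_pair_exchange) (simp_all only: word_part_simps append_Nil2 letters exchange)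
  qed
  moreover have "in_D (word_part \<iota> a b c xs (middle_ends t)) = in_D (word_part \<iota> a b c xs' (middle_ends (\<not> t)))" for t
  proof -
    have "letters \<iota> a b c xs' z = letters \<iota> a b c xs z"
      "letters \<iota> a b c xs' (opposite x) = letters \<iota> a b c xs (opposite x)"
      using xz by (auto simp: letters_eq_letter toggled roles)
    moreover have "in_D (letters \<iota> a b c xs (opposite x) @ letters \<iota> a b c xs z)
        = in_D (letters \<iota> a b c xs z @ letters \<iota> a b c xs (opposite x))"
      using letter_commute by (simp add: letters_eq_letter roles)
    ultimately show ?thesis
      unfolding middle_ends by (intro in_D_pair_exchange) simp_all
  qed
  moreover have "word_part \<iota> a b c xs' ys = word_part \<iota> a b c xs ys" if "ys \<in> {u, v, s}" for ys
    by (rule word_part_cong) (use distinct that layout in \<open>auto simp: toggled top_ends middle_ends bottom_ends\<close>)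
  ultimately show ?thesis
    using layout by (elim disjE conjE) (simp_all add: w_eq in_D_append)
qed

section \<open>Invariance under isotopy\<close>

lemma closure_diagram_member:
  assumes "ys \<in> closure_diagram xs"
  shows "closure_diagram ys = closure_diagram xs"
proof -
  have "closure_diagram ys \<subseteq> closure_diagram xs" if "ys \<in> closure_diagram xs" for xs ys :: "'a long_diagram"
    using that by (auto simp: closure_diagram_def rotate_rotate)
  then show ?thesis
    using assms closure_diagram_sym by blast
qed

lemma gauss_diagram_member:
  assumes "gauss_diagram G" "xs \<in> G"
  shows "long_gauss_diagram xs" "G = closure_diagram xs"
proof -
  obtain zs where zs: "long_gauss_diagram zs" "G = closure_diagram zs"
    using assms(1) by (auto simp: gauss_diagram_def)
  show "long_gauss_diagram xs"
    using long_gauss_diagram_rotation zs assms(2) by blast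
  show "G = closure_diagram xs"
    using closure_diagram_member zs(2) assms(2) by blast
qed

lemma end_count_chord_count:
  assumes "gauss_diagram G" "xs \<in> G"
  shows "end_count (ind G) c \<rho> xs = chord_count ind c G"
  using gauss_diagram_member[OF assms] by (simp add: end_count_eq_card chord_count_def chords_closure)

lemma w_cut_independent:
  assumes abc: "{a, b, c} = UNIV - {0}"
    and G: "gauss_diagram G" "even (chord_count ind c G)" "xs \<in> G" "ys \<in> G"
  shows "D_equiv (w (ind G) a b c xs) (w (ind G) a b c ys)"
proof (rule w_rotate[OF abc])
  show "long_gauss_diagram xs" "ys \<in> closure_diagram xs"
    using gauss_diagram_member[OF G(1,3)] G(4) by simp_all
  show "even (end_count (ind G) c \<rho> xs)" for \<rho>
    using end_count_chord_count[OF G(1,3), of ind c \<rho>] G(2) by simp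
qed

lemma end_count_cong_index:
  assumes "\<And>d. d \<in> chord_of ` set xs \<Longrightarrow> \<iota>' d = \<iota> d"
  shows "end_count \<iota>' c \<rho> xs = end_count \<iota> c \<rho> xs"
  using assms unfolding end_count_def by (intro arg_cong[of _ _ length] filter_cong) auto

text \<open>What a single step of an isotopy provides: reference points for which the two words agree in \<open>D\<close>. The
  parity of the number of chords of index \<open>c\<close> is carried along, because changing reference points needs
  it to be even on both sides.\<close>
definition matching_cuts ::
    "('c diagram \<Rightarrow> 'c \<Rightarrow> index) \<Rightarrow> index \<Rightarrow> index \<Rightarrow> index \<Rightarrow> 'c diagram \<Rightarrow> 'c diagram \<Rightarrow> bool" where
  "matching_cuts ind a b c G H \<longleftrightarrow> (\<exists>xs\<in>G. \<exists>ys\<in>H. w (ind G) a b c xs = w (ind H) a b c ys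
     \<and> (even (end_count (ind G) c Over xs) \<longleftrightarrow> even (end_count (ind H) c Over ys)))"

text \<open>It suffices to compute both words with the indices of the later diagram, as the chords that survive a
  move keep their index.\<close>
lemma matching_cutsI:
  assumes "G = closure_diagram xs" "H = closure_diagram ys"
    and kept: "\<forall>d\<in>chords G. ind H d = ind G d"
    and "w (ind H) a b c xs = w (ind H) a b c ys"
    and "even (end_count (ind H) c Over xs) \<longleftrightarrow> even (end_count (ind H) c Over ys)"
  shows "matching_cuts ind a b c G H"
proof -
  have same: "ind H d = ind G d" if "d \<in> chord_of ` set xs" for d
    using kept that unfolding assms(1) chords_closure by blast
  have "w (ind G) a b c xs = w (ind H) a b c ys"
    using w_cong_index[of xs "ind H" "ind G" a b c, OF same] assms(4) by simp
  moreover have "even (end_count (ind G) c Over xs) \<longleftrightarrow> even (end_count (ind H) c Over ys)"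
    using end_count_cong_index[of xs "ind H" "ind G" c Over, OF same] assms(5) by simp
  moreover have "xs \<in> G" "ys \<in> H"
    unfolding assms(1,2) by (rule self_in_closure)+
  ultimately show ?thesis
    unfolding matching_cuts_def by blast
qed

lemma matching_cuts_reidemeister1:
  assumes "two_parity_theory T ind" and abc: "{a, b, c} = UNIV - {0}"
    and "G \<in> T" "H \<in> T" "reidemeister1 k G H"
  shows "matching_cuts ind a b c G H"
proof -
  have gauss: "gauss_diagram G" "gauss_diagram H"
    and k: "ind H k = 0" and kept: "\<forall>d\<in>chords G. ind H d = ind G d"
    using assms unfolding two_parity_theory_def by blast+
  obtain e u where e: "chord_of e = k" and u: "G = closure_diagram u"
      "H = closure_diagram ([e, opposite e] @ u)"
    using assms(5) unfolding reidemeister1_def by blast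
  show ?thesis
  proof (rule matching_cutsI[OF u kept])
    show "w (ind H) a b c u = w (ind H) a b c ([e, opposite e] @ u)"
      using gauss e k by (intro w_reidemeister1[OF abc]) (simp_all only: u gauss_diagram_closure_iff)
    show "even (end_count (ind H) c Over u) \<longleftrightarrow> even (end_count (ind H) c Over ([e, opposite e] @ u))"
      using e k index_cases(3)[OF abc] by simp
  qed
qed

lemma matching_cuts_reidemeister2:
  assumes "two_parity_theory T ind" "G \<in> T" "H \<in> T" "reidemeister2 p q G H"
  shows "matching_cuts ind a b c G H"
proof -
  have gauss: "gauss_diagram G" "gauss_diagram H"
    and pq: "ind H p = ind H q" and kept: "\<forall>d\<in>chords G. ind H d = ind G d"
    using assms unfolding two_parity_theory_def by blast+
  obtain s u v x y where xy: "x = End p Over s" "y = End q Over (\<not> s)"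
    and "G = closure_diagram (u @ v)"
    and "H = closure_diagram ([x, y] @ u @ [opposite x, opposite y] @ v) \<or>
      H = closure_diagram ([x, y] @ u @ [opposite y, opposite x] @ v)"
    using assms(4) unfolding reidemeister2_def Let_def by blast
  then obtain m where m: "m = [opposite x, opposite y] \<or> m = [opposite y, opposite x]"
    and u: "G = closure_diagram (u @ v)" "H = closure_diagram ([x, y] @ u @ m @ v)"
    by blast
  have roles: "role_of x = Over" "role_of y = Over" and "chord_of x = p" "chord_of y = q"
    by (simp_all add: xy)
  then have equal: "ind H (chord_of x) = ind H (chord_of y)"
    using pq by simp
  show ?thesis
  proof (rule matching_cutsI[OF u kept])
    show "w (ind H) a b c (u @ v) = w (ind H) a b c ([x, y] @ u @ m @ v)"
      using gauss by (intro w_reidemeister2[OF _ refl m _ roles equal]) (simp_all only: u gauss_diagram_closure_iff)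
    show "even (end_count (ind H) c Over (u @ v))
        \<longleftrightarrow> even (end_count (ind H) c Over ([x, y] @ u @ m @ v))"
      using m roles equal by auto
  qed
qed

lemma matching_cuts_reidemeister3:
  assumes "two_parity_theory T ind" and abc: "{a, b, c} = UNIV - {0}"
    and "G \<in> T" "H \<in> T" "reidemeister3 p q r G H"
  shows "matching_cuts ind a b c G H"
proof -
  have gauss: "gauss_diagram G" "gauss_diagram H"
    and sum: "ind G p + ind G q + ind G r = 0" and kept: "\<forall>d\<in>chords G. ind H d = ind G d"
    using assms unfolding two_parity_theory_def by blast+
  obtain sp sq sr tT tM tB u v s x y z top_ends middle_ends bottom_ends
    where xyz: "x = End p Over sp" "y = End q Over sq" "z = End r Over sr"
    and ends: "top_ends = (\<lambda>t. ordered_pair t x y)" "middle_ends = (\<lambda>t. ordered_pair t (opposite x) z)"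
      "bottom_ends = (\<lambda>t. ordered_pair t (opposite y) (opposite z))"
    and "G = closure_diagram (top_ends tT @ u @ middle_ends tM @ v @ bottom_ends tB @ s) \<and>
         H = closure_diagram (top_ends (\<not> tT) @ u @ middle_ends (\<not> tM) @ v @ bottom_ends (\<not> tB) @ s)
       \<or> G = closure_diagram (top_ends tT @ u @ bottom_ends tB @ v @ middle_ends tM @ s) \<and>
         H = closure_diagram (top_ends (\<not> tT) @ u @ bottom_ends (\<not> tB) @ v @ middle_ends (\<not> tM) @ s)"
    using assms(5) unfolding reidemeister3_def Let_def by blast
  then obtain xs xs' where layout: "xs = top_ends tT @ u @ middle_ends tM @ v @ bottom_ends tB @ s
        \<and> xs' = top_ends (\<not> tT) @ u @ middle_ends (\<not> tM) @ v @ bottom_ends (\<not> tB) @ s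
      \<or> xs = top_ends tT @ u @ bottom_ends tB @ v @ middle_ends tM @ s
        \<and> xs' = top_ends (\<not> tT) @ u @ bottom_ends (\<not> tB) @ v @ middle_ends (\<not> tM) @ s"
    and G: "G = closure_diagram xs" and H: "H = closure_diagram xs'"
    by metis
  have roles: "role_of x = Over" "role_of y = Over" "role_of z = Over"
    and names: "chord_of x = p" "chord_of y = q" "chord_of z = r"
    by (simp_all add: xyz)
  have long: "long_gauss_diagram xs" "long_gauss_diagram xs'"
    using gauss by (simp_all only: G H gauss_diagram_closure_iff)
  have sets: "set xs' = set xs"
    using layout by (auto simp: ends)
  have "{p, q, r} \<subseteq> chords G"
    using layout names by (auto simp: G chords_closure ends image_iff)
  then have "ind H p = ind G p" "ind H q = ind G q" "ind H r = ind G r"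
    using kept by simp_all
  then have sum': "ind H (chord_of x) + ind H (chord_of y) + ind H (chord_of z) = 0"
    using sum by (simp only: names)
  show ?thesis
  proof (rule matching_cutsI[OF G H kept])
    show "w (ind H) a b c xs = w (ind H) a b c xs'"
      by (rule w_reidemeister3[OF abc roles ends layout long(1) sum'])
    show "even (end_count (ind H) c Over xs) \<longleftrightarrow> even (end_count (ind H) c Over xs')"
      by (simp only: end_count_eq_card[OF long(1)] end_count_eq_card[OF long(2)] sets)
  qed
qed

lemma map_chord_end_simps [simp]:
  "chord_of (map_chord_end f e) = f (chord_of e)" "role_of (map_chord_end f e) = role_of e"
  "opposite (map_chord_end f e) = map_chord_end f (opposite e)"
  by (cases e; simp add: opposite_def)+

text \<open>A renaming that is injective on the chords carries ends to ends compatibly with roles, opposites and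
  the order along the line, so all counts and all letters stay the same.\<close>
lemma matching_cuts_renaming:
  assumes gauss: "gauss_diagram G" and "same_up_to_names ind G H"
  shows "matching_cuts ind a b c G H"
proof -
  obtain f where inj: "inj_on f (chords G)" and H: "H = map (map_chord_end f) ` G"
    and ind: "\<forall>d\<in>chords G. ind H (f d) = ind G d"
    using assms(2) unfolding same_up_to_names_def by blast
  obtain xs where xs: "long_gauss_diagram xs" "G = closure_diagram xs"
    using gauss by (auto simp: gauss_diagram_def)
  let ?h = "map_chord_end f"
  let ?ys = "map ?h xs"
  have chord: "ind H (f (chord_of e)) = ind G (chord_of e)" if "e \<in> set xs" for e
    using ind that by (auto simp: xs(2) chords_closure)
  have inj_h: "?h e = ?h g \<longleftrightarrow> e = g" if "e \<in> set xs" "g \<in> set xs" for e g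
  proof -
    have "f (chord_of e) = f (chord_of g) \<longleftrightarrow> chord_of e = chord_of g"
      using inj that by (intro inj_on_eq_iff[of f "chords G"]) (auto simp: xs(2) chords_closure)
    then show ?thesis
      by (cases e; cases g) simp
  qed
  have counts: "end_count (ind H) c \<rho> (map ?h zs) = end_count (ind G) c \<rho> zs" if "set zs \<subseteq> set xs" for \<rho> zs
    using that by (induction zs) (auto simp: chord)
  have before: "before (?h g) (map ?h zs) = map ?h (before g zs)" if "g \<in> set xs" "set zs \<subseteq> set xs" for g zs
    using that by (induction zs) (auto simp: inj_h)
  have "letters (ind H) a b c ?ys (?h e) = letters (ind G) a b c xs e" if "e \<in> set xs" for e
  proof -
    have "set (before (opposite e) xs) \<subseteq> set xs"
      by (auto dest: set_takeWhileD)
    then have "primed (ind H) c ?ys (?h e) = primed (ind G) c xs e"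
      using opposite_in_long_diagram[OF xs(1) that] by (simp add: primed_iff before counts)
    then show ?thesis
      using chord[OF that] by (simp add: letters_eq_letter)
  qed
  then have "w (ind H) a b c ?ys = w (ind G) a b c xs"
    by (simp add: w_def w_word_def comp_def cong: map_cong)
  moreover have "end_count (ind H) c Over ?ys = end_count (ind G) c Over xs"
    by (rule counts) simp
  moreover have "xs \<in> G"
    by (simp add: xs(2) self_in_closure)
  moreover have "?ys \<in> H"
    unfolding H using \<open>xs \<in> G\<close> by (rule imageI)
  ultimately show ?thesis
    unfolding matching_cuts_def by metis
qed

lemma isotopy_step_matching_cuts:
  assumes theory_T: "two_parity_theory T ind" and abc: "{a, b, c} = UNIV - {0}"
    and "isotopy_step T ind G H"
  shows "matching_cuts ind a b c G H"
proof -
  have T: "G \<in> T" "H \<in> T" and gauss: "gauss_diagram G"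
    using assms unfolding isotopy_step_def two_parity_theory_def by blast+
  from assms(3) show ?thesis
    unfolding isotopy_step_def
    using matching_cuts_reidemeister1[OF theory_T abc T] matching_cuts_reidemeister2[OF theory_T T]
      matching_cuts_reidemeister3[OF theory_T abc T] matching_cuts_renaming[OF gauss] by blast
qed

lemma isotopy_step_parity:
  assumes "two_parity_theory T ind" "{a, b, c} = UNIV - {0}" "isotopy_step T ind G H"
  shows "even (chord_count ind c G) \<longleftrightarrow> even (chord_count ind c H)"
proof -
  have "gauss_diagram G" "gauss_diagram H"
    using assms unfolding isotopy_step_def two_parity_theory_def by blast+
  then show ?thesis
    using isotopy_step_matching_cuts[OF assms] unfolding matching_cuts_def
    by (metis end_count_chord_count)
qed

text \<open>This is why it does not matter which diagram witnesses that a knot is \<open>c\<close>-even.\<close>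
lemma isotopic_parity:
  assumes "two_parity_theory T ind" "{a, b, c} = UNIV - {0}" "isotopic T ind G H"
  shows "even (chord_count ind c G) \<longleftrightarrow> even (chord_count ind c H)"
  using assms(3) unfolding isotopic_def
proof (induction rule: equivclp_induct)
  case (step H H')
  then show ?case
    using isotopy_step_parity[OF assms(1,2)] by blast
qed simp

lemma even_knot_chord_count:
  assumes "two_parity_theory T ind" "{a, b, c} = UNIV - {0}" "even_knot T ind c G"
  shows "even (chord_count ind c G)"
  using assms(3) isotopic_parity[OF assms(1,2)] unfolding even_knot_def chord_count_def by blast

lemma isotopy_step_D_equiv:
  assumes theory_T: "two_parity_theory T ind" and abc: "{a, b, c} = UNIV - {0}"
    and step: "isotopy_step T ind G H" and even: "even (chord_count ind c G)"
    and "xs \<in> G" "ys \<in> H"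
  shows "D_equiv (w (ind G) a b c xs) (w (ind H) a b c ys)"
proof -
  have gauss: "gauss_diagram G" "gauss_diagram H"
    using step theory_T unfolding isotopy_step_def two_parity_theory_def by blast+
  have even': "even (chord_count ind c H)"
    using even isotopy_step_parity[OF theory_T abc step] by simp
  obtain xs' ys' where cuts: "xs' \<in> G" "ys' \<in> H"
    and same: "w (ind G) a b c xs' = w (ind H) a b c ys'"
    using isotopy_step_matching_cuts[OF theory_T abc step] unfolding matching_cuts_def by blast
  have "D_equiv (w (ind G) a b c xs) (w (ind G) a b c xs')"
    using assms(5) cuts(1) by (intro w_cut_independent[OF abc gauss(1) even])
  moreover have "D_equiv (w (ind H) a b c ys') (w (ind H) a b c ys)"
    using assms(6) cuts(2) by (intro w_cut_independent[OF abc gauss(2) even'])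
  ultimately show ?thesis
    unfolding same by (rule D_equiv_trans)
qed

lemma isotopic_D_equiv:
  assumes theory_T: "two_parity_theory T ind" and abc: "{a, b, c} = UNIV - {0}"
    and "isotopic T ind K K'" "K \<in> T" and even: "even (chord_count ind c K)"
    and xs: "xs \<in> K" and "ys \<in> K'"
  shows "D_equiv (w (ind K) a b c xs) (w (ind K') a b c ys)"
  using assms(3) assms(7) unfolding isotopic_def
proof (induction arbitrary: ys rule: equivclp_induct)
  case base
  have "gauss_diagram K"
    using theory_T \<open>K \<in> T\<close> by (simp add: two_parity_theory_def)
  then show ?case
    using xs base by (intro w_cut_independent[OF abc _ even])
next
  case (step H H')
  have even': "even (chord_count ind c H)" "even (chord_count ind c H')"
    using isotopic_parity[OF theory_T abc, unfolded isotopic_def] step.hyps even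
      isotopy_step_parity[OF theory_T abc] by blast+
  have "gauss_diagram H"
    using step.hyps(2) theory_T unfolding isotopy_step_def two_parity_theory_def by blast
  then obtain zs where zs: "zs \<in> H"
    unfolding gauss_diagram_def using self_in_closure by blast
  have "D_equiv (w (ind H) a b c zs) (w (ind H') a b c ys)"
    using step.hyps(2)
  proof
    assume "isotopy_step T ind H H'"
    then show ?thesis
      using zs step.prems by (rule isotopy_step_D_equiv[OF theory_T abc _ even'(1)])
  next
    assume "isotopy_step T ind H' H"
    then show ?thesis
      using step.prems zs by (intro D_equiv_sym[OF isotopy_step_D_equiv[OF theory_T abc _ even'(2)]])
  qed
  with step.IH[OF zs] show ?case
    by (rule D_equiv_trans)
qed

theorem theorem2:
  fixes T :: "'c diagram set"
    and ind :: "'c diagram \<Rightarrow> 'c \<Rightarrow> index"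
    and a b c :: index
    and K K' :: "'c diagram"
    and G G' :: "'c long_diagram"
  assumes "two_parity_theory T ind"
    and "{a, b, c} = UNIV - {0}"
    and "K \<in> T" and "K' \<in> T"
    and "isotopic T ind K K'"
    and "even_knot T ind c K" and "even_knot T ind c K'"
    and "G \<in> K" and "G' \<in> K'"
  shows "\<exists>\<phi> \<psi> \<chi>. is_phi \<phi> \<and> is_psi \<psi> \<and> \<chi> \<in> iso D D
      \<and> (\<forall>x\<in>carrier D. \<chi> x = \<phi> (\<psi> x) \<and> \<chi> x = \<psi> (\<phi> x))
      \<and> (conj_or_apply {\<phi>, \<psi>, \<chi>})\<^sup>*\<^sup>* (w (ind K) a b c G) (w (ind K') a b c G')
      \<and> (conj_or_apply {\<phi>, \<psi>, \<chi>})\<^sup>*\<^sup>* (w (ind K') a b c G') (w (ind K) a b c G)"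
proof -
  let ?\<phi> = "swap_primes Under" and ?\<psi> = "swap_primes Over"
  have "even (chord_count ind c K)"
    using assms(1,2,6) by (rule even_knot_chord_count)
  then have "D_equiv (w (ind K) a b c G) (w (ind K') a b c G')"
    using assms by (intro isotopic_D_equiv[of T ind a b c K K'])
  moreover from this have "D_equiv (w (ind K') a b c G') (w (ind K) a b c G)"
    by (rule D_equiv_sym)
  moreover have "?\<phi> \<circ> ?\<psi> \<in> iso D D"
    by (rule iso_set_trans[OF swap_primes_iso swap_primes_iso])
  moreover have "\<forall>x\<in>carrier D. (?\<phi> \<circ> ?\<psi>) x = ?\<phi> (?\<psi> x) \<and> (?\<phi> \<circ> ?\<psi>) x = ?\<psi> (?\<phi> x)"
    using swap_primes_commute[of _ Under Over] by simp
  ultimately show ?thesis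
    unfolding D_equiv_def
    by (intro exI[of _ ?\<phi>] exI[of _ ?\<psi>] exI[of _ "?\<phi> \<circ> ?\<psi>"] conjI is_phi_swap_primes is_psi_swap_primes)
qed

end
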